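(* For every finite domain $\mathcal D$, the red-spin marginal $\nu_{\mathcal D}$ of $\mu_{\mathcal D}$ satisfies the FKG inequality: for any two increasing events $A,B\subset\{+,-\}^{F(\mathcal D)}$, $\nu_{\mathcal D}(A\cap B)\ge\nu_{\mathcal D}(A)\,\nu_{\mathcal D}(B)$.
   Context: $\mathbb H$ is the hexagonal lattice. A domain is a subgraph $\mathcal D$ of $\mathbb H$ without isolated vertices for which there exists a self-avoiding polygon $\partial_E\mathcal D$ such that $E(\mathcal D)$ is the set of edges in the bounded component of $\mathbb H\setminus\partial_E\mathcal D$; $F(\mathcal D)$ is the set of faces adjacent to an edge of $\mathcal D$. A pair $(\sigma_r,\sigma_b)\in\{+,-\}^{F(\mathcal D)}\times\{+,-\}^{F(\mathcal D)}$ is coherent if for all adjacent faces $u,v\in F(\mathcal D)$, $\sigma_r(u)=\sigma_r(v)$ or $\sigma_b(u)=\sigma_b(v)$; $\mu_{\mathcal D}$ is the uniform measure on coherent pairs and $\nu_{\mathcal D}$ the law of $\sigma_r$ under it. $\{+,-\}^{F(\mathcal D)}$ is ordered pointwise with $-\le+$; an event is increasing if it is closed under raising spins. *)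

theory Defs
  imports "HOL-Analysis.Analysis"
begin

text \<open>Faces of the hexagonal lattice H are indexed by the triangular lattice Z^2:
  the face (a,b) is the regular hexagon centred at a + b*w (w = exp(i pi/3)), with
  adjacent centres at distance 1.  Two faces are adjacent iff they share an edge of H.\<close>

type_synonym face = "int \<times> int"

definition hex_adj :: "face \<Rightarrow> face \<Rightarrow> bool" where
  "hex_adj u v \<longleftrightarrow> (fst v - fst u, snd v - snd u) \<in>
     {(1,0), (-1,0), (0,1), (0,-1), (1,-1), (-1,1)}"

definition omega :: complex where
  "omega = Complex (1/2) (sqrt 3 / 2)"

definition center :: "face \<Rightarrow> complex" where
  "center u = of_int (fst u) + of_int (snd u) * omega"

text \<open>The edge of H separating adjacent faces u and v is the segment between the
  centroids of the two lattice triangles containing u and v.\<close>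

definition edge_end1 :: "face \<Rightarrow> face \<Rightarrow> complex" where
  "edge_end1 u v = center u + (center v - center u) * ((1 + omega) / 3)"

definition edge_end2 :: "face \<Rightarrow> face \<Rightarrow> complex" where
  "edge_end2 u v = center u + (center v - center u) * ((1 + cnj omega) / 3)"

definition H_edge :: "complex \<Rightarrow> complex \<Rightarrow> bool" where
  "H_edge x y \<longleftrightarrow> (\<exists>u v. hex_adj u v \<and> {x, y} = {edge_end1 u v, edge_end2 u v})"

definition self_avoiding_polygon :: "complex list \<Rightarrow> bool" where
  "self_avoiding_polygon ps \<longleftrightarrow> length ps \<ge> 3 \<and> distinct ps \<and>
     (\<forall>i < length ps. H_edge (ps ! i) (ps ! ((i + 1) mod length ps)))"

definition polygon_trace :: "complex list \<Rightarrow> complex set" where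
  "polygon_trace ps = (\<Union>i < length ps. closed_segment (ps ! i) (ps ! ((i + 1) mod length ps)))"

definition dom_edges :: "complex list \<Rightarrow> (face \<times> face) set" where
  "dom_edges ps = {(u, v). hex_adj u v \<and>
      open_segment (edge_end1 u v) (edge_end2 u v) \<subseteq> inside (polygon_trace ps)}"

definition dom_faces :: "complex list \<Rightarrow> face set" where
  "dom_faces ps = {f. \<exists>(u, v) \<in> dom_edges ps. f = u \<or> f = v}"

text \<open>Spin configurations on F, with True = + and False = - (so - \<le> +).\<close>
definition spins :: "face set \<Rightarrow> (face \<Rightarrow> bool) set" where
  "spins F = F \<rightarrow>\<^sub>E (UNIV :: bool set)"

definition coherent_pairs :: "face set \<Rightarrow> ((face \<Rightarrow> bool) \<times> (face \<Rightarrow> bool)) set" where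
  "coherent_pairs F = {(r, b). r \<in> spins F \<and> b \<in> spins F \<and>
     (\<forall>u \<in> F. \<forall>v \<in> F. hex_adj u v \<longrightarrow> r u = r v \<or> b u = b v)}"

text \<open>nu_D(A): law of the red spins under the uniform measure on coherent pairs.\<close>
definition nu :: "face set \<Rightarrow> (face \<Rightarrow> bool) set \<Rightarrow> real" where
  "nu F A = real (card {p \<in> coherent_pairs F. fst p \<in> A}) / real (card (coherent_pairs F))"

definition increasing_event :: "face set \<Rightarrow> (face \<Rightarrow> bool) set \<Rightarrow> bool" where
  "increasing_event F A \<longleftrightarrow> A \<subseteq> spins F \<and>
     (\<forall>\<sigma> \<in> A. \<forall>\<tau> \<in> spins F. (\<forall>f \<in> F. \<sigma> f \<le> \<tau> f) \<longrightarrow> \<tau> \<in> A)"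

end

theory Submission
  imports Defs
begin

text \<open>Given the red spins \<open>r\<close>, the blue spins may change only across edges between faces of equal red
  spin. In every triangle of mutually adjacent faces the edges with two \<open>+\<close> ends and those with two \<open>-\<close>
  ends never occur together, so the coboundary of a coherent blue configuration splits into a cocycle
  living on the \<open>+\<close> edges and one living on the \<open>-\<close> edges. A domain has no holes, hence its first
  cohomology over the two-element field vanishes and both parts are again coboundaries. The number of
  blue configurations is therefore, up to a constant, the product of the orders of two groups
  \<open>K\<^sub>+(r)\<close> and \<open>K\<^sub>-(r)\<close>. As \<open>K\<^sub>+(r \<and> s) = K\<^sub>+(r) \<inter> K\<^sub>+(s)\<close> and
  \<open>K\<^sub>+(r) + K\<^sub>+(s) \<subseteq> K\<^sub>+(r \<or> s)\<close>, the formula \<open>|H| |K| = |H + K| |H \<inter> K|\<close> shows that each factor is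
  log-supermodular in \<open>r\<close>, and the four functions theorem gives the FKG inequality.

  The absence of holes comes from the connectedness of the exterior of the polygon: a finite cluster
  of faces enclosed by the domain would have a boundary point in the exterior, all hexagons around
  which again belong to the cluster.\<close>

section \<open>The four functions theorem\<close>

text \<open>The Ahlswede-Daykin inequality on a one-element ground set. The cross terms
  \<open>x = a0 * b1\<close> and \<open>y = a1 * b0\<close> are at most \<open>m = c1 * d0\<close>,
  and their product is at most \<open>m * (c0 * d1)\<close>. For \<open>m > 0\<close>, expanding
  \<open>0 \<le> (m - x) * (m - y)\<close> gives \<open>x + y \<le> m + c0 * d1\<close>.\<close>

lemma four_function_two_point:
  fixes a0 a1 b0 b1 c0 c1 d0 d1 :: real
  assumes nonneg: "0 \<le> a0" "0 \<le> a1" "0 \<le> b0" "0 \<le> b1" "0 \<le> c0" "0 \<le> c1" "0 \<le> d0" "0 \<le> d1"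
    and le: "a0 * b0 \<le> c0 * d0" "a0 * b1 \<le> c1 * d0" "a1 * b0 \<le> c1 * d0" "a1 * b1 \<le> c1 * d1"
  shows "(a0 + a1) * (b0 + b1) \<le> (c0 + c1) * (d0 + d1)"
proof -
  define m where "m = c1 * d0"
  have "a0 * b1 + a1 * b0 \<le> m + c0 * d1"
  proof (cases "m = 0")
    case True
    then show ?thesis
      using le(2,3) mult_nonneg_nonneg[OF nonneg(5,8)] unfolding m_def by linarith
  next
    case False
    then have m: "m > 0"
      using nonneg unfolding m_def by (simp add: less_le)
    have "(a0 * b0) * (a1 * b1) \<le> (c0 * d0) * (c1 * d1)"
      by (rule mult_mono[OF le(1,4)]) (use nonneg in auto)
    then have "(a0 * b1) * (a1 * b0) \<le> m * (c0 * d1)"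
      unfolding m_def by (simp add: mult_ac)
    moreover have "0 \<le> (m - a0 * b1) * (m - a1 * b0)"
      using le unfolding m_def by simp
    ultimately have "m * (a0 * b1 + a1 * b0) \<le> m * (m + c0 * d1)"
      by (simp add: algebra_simps)
    with m show ?thesis
      by simp
  qed
  then show ?thesis
    using le unfolding m_def by (simp add: algebra_simps)
qed

lemma sum_Pow_insert:
  fixes f :: "'a set \<Rightarrow> 'b::comm_monoid_add"
  assumes "finite F" "x \<notin> F"
  shows "sum f (Pow (insert x F)) = (\<Sum>S\<in>Pow F. f S + f (insert x S))"
proof -
  have "inj_on (insert x) (Pow F)"
    using assms(2) by (auto simp: inj_on_def)
  moreover have "Pow F \<inter> insert x ` Pow F = {}"
    using assms(2) by auto
  ultimately show ?thesis
    using assms(1) by (simp add: Pow_insert sum.union_disjoint sum.reindex sum.distrib)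
qed

text \<open>The theorem of Ahlswede and Daykin, by induction on the ground set. Each function is
  replaced by the sum of its values at \<open>S\<close> and at \<open>insert x S\<close>; that the
  four new functions on subsets of \<open>F\<close> satisfy the hypothesis is the two-point
  inequality.\<close>

theorem four_functions:
  fixes \<alpha> \<beta> \<gamma> \<delta> :: "'a set \<Rightarrow> real"
  assumes "finite F"
    and "\<And>S. S \<subseteq> F \<Longrightarrow> 0 \<le> \<alpha> S" "\<And>S. S \<subseteq> F \<Longrightarrow> 0 \<le> \<beta> S"
    and "\<And>S. S \<subseteq> F \<Longrightarrow> 0 \<le> \<gamma> S" "\<And>S. S \<subseteq> F \<Longrightarrow> 0 \<le> \<delta> S"
    and "\<And>S T. S \<subseteq> F \<Longrightarrow> T \<subseteq> F \<Longrightarrow> \<alpha> S * \<beta> T \<le> \<gamma> (S \<union> T) * \<delta> (S \<inter> T)"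
  shows "sum \<alpha> (Pow F) * sum \<beta> (Pow F) \<le> sum \<gamma> (Pow F) * sum \<delta> (Pow F)"
  using assms
proof (induction F arbitrary: \<alpha> \<beta> \<gamma> \<delta> rule: finite_induct)
  case empty
  from empty(5)[of "{}" "{}"] show ?case by simp
next
  case (insert x F)
  note le = insert.prems(5)
  show ?case
    unfolding sum_Pow_insert[OF insert.hyps]
  proof (rule insert.IH)
    fix S T assume ST: "S \<subseteq> F" "T \<subseteq> F"
    then have x: "x \<notin> S" "x \<notin> T"
      using insert.hyps by auto
    have sub: "S \<subseteq> insert x F" "T \<subseteq> insert x F"
      "insert x S \<subseteq> insert x F" "insert x T \<subseteq> insert x F"
      "S \<union> T \<subseteq> insert x F" "insert x (S \<union> T) \<subseteq> insert x F"
      "S \<inter> T \<subseteq> insert x F" "insert x (S \<inter> T) \<subseteq> insert x F"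
      using ST by auto
    show "(\<alpha> S + \<alpha> (insert x S)) * (\<beta> T + \<beta> (insert x T))
      \<le> (\<gamma> (S \<union> T) + \<gamma> (insert x (S \<union> T))) * (\<delta> (S \<inter> T) + \<delta> (insert x (S \<inter> T)))"
      using le[OF sub(1,2)] le[OF sub(1,4)] le[OF sub(3,2)] le[OF sub(3,4)] x
      by (intro four_function_two_point insert.prems(1-4) sub) auto
  qed (use insert.prems(1-4) in \<open>auto intro!: add_nonneg_nonneg simp: subset_insertI2\<close>)
qed

text \<open>The four functions are \<open>w\<close> times the indicators of \<open>A\<close>, of
  \<open>B\<close> and of \<open>A \<inter> B\<close>, and \<open>w\<close> itself. For
  \<open>S \<in> A\<close> and \<open>T \<in> B\<close> the union \<open>S \<union> T\<close> lies
  in both up-sets.\<close>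

corollary fkg_inequality:
  fixes w :: "'a set \<Rightarrow> real"
  assumes "finite F" and w: "\<And>S. S \<subseteq> F \<Longrightarrow> 0 \<le> w S"
    and supermodular: "\<And>S T. S \<subseteq> F \<Longrightarrow> T \<subseteq> F \<Longrightarrow> w S * w T \<le> w (S \<union> T) * w (S \<inter> T)"
    and A: "\<And>S T. S \<in> A \<Longrightarrow> S \<subseteq> T \<Longrightarrow> T \<subseteq> F \<Longrightarrow> T \<in> A"
    and B: "\<And>S T. S \<in> B \<Longrightarrow> S \<subseteq> T \<Longrightarrow> T \<subseteq> F \<Longrightarrow> T \<in> B"
  shows "sum w (Pow F \<inter> A) * sum w (Pow F \<inter> B) \<le> sum w (Pow F \<inter> (A \<inter> B)) * sum w (Pow F)"
proof -
  have *: "sum w (Pow F \<inter> C) = (\<Sum>S\<in>Pow F. w S * of_bool (S \<in> C))" for C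
    using \<open>finite F\<close> by (auto simp: sum.inter_restrict intro!: sum.cong)
  show ?thesis
    unfolding *
  proof (rule four_functions[OF \<open>finite F\<close>])
    fix S T assume ST: "S \<subseteq> F" "T \<subseteq> F"
    show "w S * of_bool (S \<in> A) * (w T * of_bool (T \<in> B))
        \<le> w (S \<union> T) * of_bool (S \<union> T \<in> A \<inter> B) * w (S \<inter> T)"
    proof (cases "S \<in> A \<and> T \<in> B")
      case True
      then have "S \<union> T \<in> A \<inter> B"
        using A[of S "S \<union> T"] B[of T "S \<union> T"] ST by auto
      then show ?thesis
        using True supermodular[OF ST] by simp
    next
      case False
      have "0 \<le> w (S \<union> T)" "0 \<le> w (S \<inter> T)"
        using ST by (auto intro!: w)
      with False show ?thesis
        by auto
    qed
  qed (use w in auto)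
qed

section \<open>Counting coherent blue configurations\<close>

text \<open>The product formula for subgroups of an elementary abelian 2-group, by an explicit
  bijection: two decompositions of \<open>x\<close> into a summand from \<open>H\<close> and one
  from \<open>K\<close> differ by an element of \<open>H \<inter> K\<close>.\<close>

lemma card_sym_diff_subgroups:
  fixes H K :: "'a set set"
  assumes H: "\<And>a b. a \<in> H \<Longrightarrow> b \<in> H \<Longrightarrow> sym_diff a b \<in> H"
    and K: "\<And>a b. a \<in> K \<Longrightarrow> b \<in> K \<Longrightarrow> sym_diff a b \<in> K"
  shows "card H * card K = card {sym_diff a b | a b. a \<in> H \<and> b \<in> K} * card (H \<inter> K)"
proof -
  define d :: "'a set \<Rightarrow> 'a set \<Rightarrow> 'a set" where "d a b = sym_diff a b" for a b
  have cancel: "d a (d a b) = b" and comm: "d a b = d b a" and assoc: "d (d a b) c = d a (d b c)"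
    for a b c
    unfolding d_def by auto
  have cancel_right: "d a (d b b) = a" for a b
    unfolding d_def by auto
  have left_comm: "d a (d b c) = d b (d a c)" for a b c
    by (metis assoc comm)
  define S where "S = {d a b | a b. a \<in> H \<and> b \<in> K}"
  have "\<exists>a. a \<in> H \<and> d a x \<in> K" if "x \<in> S" for x
    using that cancel unfolding S_def by auto
  then obtain \<pi> where \<pi>: "\<And>x. x \<in> S \<Longrightarrow> \<pi> x \<in> H" "\<And>x. x \<in> S \<Longrightarrow> d (\<pi> x) x \<in> K"
    by metis
  \<comment> \<open>\<open>\<pi> x\<close> and \<open>d (\<pi> x) x\<close> form a chosen
    decomposition of \<open>x\<close>; adding \<open>k\<close> to both summands runs through all the
    others.\<close>
  let ?g = "\<lambda>(x, k). (d (\<pi> x) k, d (d (\<pi> x) x) k)"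
  have "bij_betw ?g (S \<times> (H \<inter> K)) (H \<times> K)"
  proof (rule bij_betwI[where g = "\<lambda>(a, b). (d a b, d (\<pi> (d a b)) a)"])
    show "?g \<in> S \<times> (H \<inter> K) \<rightarrow> H \<times> K"
      using \<pi> H K by (auto simp: d_def[symmetric])
    show "(\<lambda>(a, b). (d a b, d (\<pi> (d a b)) a)) \<in> H \<times> K \<rightarrow> S \<times> (H \<inter> K)"
    proof (rule Pi_I, elim SigmaE, hypsubst, unfold prod.case)
      fix a b assume ab: "a \<in> H" "b \<in> K"
      then have x: "d a b \<in> S"
        unfolding S_def by blast
      have "d (d (\<pi> (d a b)) (d a b)) b = d (\<pi> (d a b)) a"
        by (simp add: assoc cancel comm[of _ b] left_comm[of _ b])
      then show "(d a b, d (\<pi> (d a b)) a) \<in> S \<times> (H \<inter> K)"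
        using x ab \<pi>[OF x] H[of "\<pi> (d a b)" a] K[of "d (\<pi> (d a b)) (d a b)" b]
        by (simp add: d_def[symmetric])
    qed
    have "d (d p k) (d (d p x) k) = x" for p k x
      by (simp add: assoc cancel comm[of _ k] left_comm[of _ k])
    then show "(\<lambda>(a, b). (d a b, d (\<pi> (d a b)) a)) (?g p) = p" if "p \<in> S \<times> (H \<inter> K)" for p
      by (cases p) (simp add: cancel)
    show "?g ((\<lambda>(a, b). (d a b, d (\<pi> (d a b)) a)) p) = p" if "p \<in> H \<times> K" for p
      by (cases p) (simp add: cancel cancel_right assoc comm left_comm)
  qed
  then have "card (S \<times> (H \<inter> K)) = card (H \<times> K)"
    by (rule bij_betw_same_card)
  then show ?thesis
    by (simp add: card_cartesian_product S_def d_def)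
qed

text \<open>Vanishing of the first cohomology, with coefficients in the two-element field, of the complex whose
  simplices are the sets of mutually adjacent faces of \<open>F\<close>; the boolean \<open>\<noteq>\<close> plays the role of addition.\<close>

definition cocycles_exact :: "face set \<Rightarrow> bool" where
  "cocycles_exact F \<longleftrightarrow> (\<forall>e :: face \<Rightarrow> face \<Rightarrow> bool.
     (\<forall>u\<in>F. \<forall>v\<in>F. hex_adj u v \<longrightarrow> e u v = e v u) \<longrightarrow>
     (\<forall>u\<in>F. \<forall>v\<in>F. \<forall>w\<in>F. hex_adj u v \<longrightarrow> hex_adj v w \<longrightarrow> hex_adj u w \<longrightarrow>
        e u w = (e u v \<noteq> e v w)) \<longrightarrow>
     (\<exists>f :: face \<Rightarrow> bool. \<forall>u\<in>F. \<forall>v\<in>F. hex_adj u v \<longrightarrow> e u v = (f u \<noteq> f v)))"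

lemma cocycles_exactD:
  assumes "cocycles_exact F"
    and "\<And>u v. u \<in> F \<Longrightarrow> v \<in> F \<Longrightarrow> hex_adj u v \<Longrightarrow> e u v = e v u"
    and "\<And>u v w. u \<in> F \<Longrightarrow> v \<in> F \<Longrightarrow> w \<in> F \<Longrightarrow> hex_adj u v \<Longrightarrow> hex_adj v w \<Longrightarrow> hex_adj u w
        \<Longrightarrow> e u w = (e u v \<noteq> e v w)"
  shows "\<exists>f :: face \<Rightarrow> bool. \<forall>u\<in>F. \<forall>v\<in>F. hex_adj u v \<longrightarrow> e u v = (f u \<noteq> f v)"
  using assms(1)[unfolded cocycles_exact_def, rule_format, of e] assms(2,3) by blast

text \<open>From here on a spin configuration is represented by the set of its \<open>+\<close> faces, so that pointwise
  multiplication of spins becomes symmetric difference.\<close>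

definition cut_within :: "face set \<Rightarrow> (face \<Rightarrow> face \<Rightarrow> bool) \<Rightarrow> face set set" where
  "cut_within F P = {b \<in> Pow F. \<forall>u\<in>F. \<forall>v\<in>F. hex_adj u v \<longrightarrow> (u \<in> b \<longleftrightarrow> v \<in> b) \<or> P u v}"

definition blue_sets :: "face set \<Rightarrow> face set \<Rightarrow> face set set" where
  "blue_sets F r = cut_within F (\<lambda>u v. u \<in> r \<longleftrightarrow> v \<in> r)"

lemma finite_cut_within: "finite F \<Longrightarrow> finite (cut_within F P)"
  by (simp add: cut_within_def)

lemma cut_within_sym_diff:
  "a \<in> cut_within F P \<Longrightarrow> b \<in> cut_within F P \<Longrightarrow> sym_diff a b \<in> cut_within F P"
  unfolding cut_within_def by auto

lemma card_cut_within_mult: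
  "card (cut_within F P) * card (cut_within F Q)
    = card {sym_diff a b | a b. a \<in> cut_within F P \<and> b \<in> cut_within F Q}
      * card (cut_within F (\<lambda>u v. P u v \<and> Q u v))"
proof -
  have "cut_within F P \<inter> cut_within F Q = cut_within F (\<lambda>u v. P u v \<and> Q u v)"
    unfolding cut_within_def by blast
  then show ?thesis
    using card_sym_diff_subgroups[OF cut_within_sym_diff cut_within_sym_diff, of F P F Q]
    by simp
qed

text \<open>The sum of the two groups lies in the group of the disjunction, so the product formula
  becomes an inequality.\<close>

lemma card_cut_within_supermodular:
  assumes "finite F"
  shows "card (cut_within F P) * card (cut_within F Q)
    \<le> card (cut_within F (\<lambda>u v. P u v \<or> Q u v)) * card (cut_within F (\<lambda>u v. P u v \<and> Q u v))"
proof -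
  have "{sym_diff a b | a b. a \<in> cut_within F P \<and> b \<in> cut_within F Q}
      \<subseteq> cut_within F (\<lambda>u v. P u v \<or> Q u v)"
    unfolding cut_within_def by auto
  then show ?thesis
    unfolding card_cut_within_mult[of F P Q]
    by (intro mult_right_mono card_mono finite_cut_within assms) auto
qed

lemma cut_within_mono:
  "(\<And>u v. P u v \<Longrightarrow> Q u v) \<Longrightarrow> cut_within F P \<subseteq> cut_within F Q"
  unfolding cut_within_def by blast

lemma hex_adj_Pair:
  "hex_adj (a, b) (c, d) \<longleftrightarrow> (c, d) \<in> {(a+1,b), (a-1,b), (a,b+1), (a,b-1), (a+1,b-1), (a-1,b+1)}"
proof -
  have "(c - a, d - b) = (x, y) \<longleftrightarrow> (c, d) = (a + x, b + y)" for x y :: int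
    unfolding prod.inject by linarith
  from this[of 1 0] this[of "-1" 0] this[of 0 1] this[of 0 "-1"] this[of 1 "-1"] this[of "-1" 1]
  show ?thesis
    unfolding hex_adj_def fst_conv snd_conv insert_iff empty_iff by simp
qed
lemma hex_adj_sym: "hex_adj u v \<longleftrightarrow> hex_adj v u"
  by (cases u; cases v) (auto simp: hex_adj_Pair)

lemma blue_sets_split:
  assumes "cocycles_exact F"
  shows "{sym_diff a b | a b. a \<in> cut_within F (\<lambda>u v. u \<in> r \<and> v \<in> r)
            \<and> b \<in> cut_within F (\<lambda>u v. u \<notin> r \<and> v \<notin> r)} = blue_sets F r"
    (is "{sym_diff a b | a b. a \<in> ?P \<and> b \<in> ?M} = _")
proof (intro subset_antisym subsetI)
  fix x assume "x \<in> {sym_diff a b | a b. a \<in> ?P \<and> b \<in> ?M}"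
  then obtain a b where "a \<in> ?P" "b \<in> ?M" and x: "x = sym_diff a b"
    by blast
  moreover have "?P \<subseteq> blue_sets F r" "?M \<subseteq> blue_sets F r"
    unfolding blue_sets_def by (auto intro!: cut_within_mono)
  ultimately show "x \<in> blue_sets F r"
    unfolding x blue_sets_def by (intro cut_within_sym_diff) blast+
next
  fix x assume x: "x \<in> blue_sets F r"
  define e where "e u v \<longleftrightarrow> (u \<in> x) \<noteq> (v \<in> x) \<and> u \<in> r \<and> v \<in> r" for u v
  have coh: "(u \<in> x) = (v \<in> x) \<or> (u \<in> r) = (v \<in> r)" if "u \<in> F" "v \<in> F" "hex_adj u v" for u v
    using x that unfolding blue_sets_def cut_within_def by blast
  have e_sym: "e u v = e v u" for u v
    by (auto simp: e_def)
  \<comment> \<open>If exactly one face of the triangle is outside \<open>r\<close>, then by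
    coherence \<open>x\<close> is constant along the two edges at it, hence along the third, and
    \<open>e\<close> vanishes on the triangle. If more are outside, \<open>e\<close> vanishes by
    definition; if none is, \<open>e\<close> is the coboundary of \<open>x\<close> there.\<close>
  have e_cocycle: "e u w = (e u v \<noteq> e v w)"
    if "u \<in> F" "v \<in> F" "w \<in> F" "hex_adj u v" "hex_adj v w" "hex_adj u w" for u v w
    using coh[OF that(1,2,4)] coh[OF that(2,3,5)] coh[OF that(1,3,6)]
    unfolding e_def by argo
  obtain f :: "face \<Rightarrow> bool"
    where "\<forall>u\<in>F. \<forall>v\<in>F. hex_adj u v \<longrightarrow> e u v = (f u \<noteq> f v)"
    using cocycles_exactD[OF assms e_sym e_cocycle] ..
  note f = this[rule_format]
  define a where "a = {u \<in> F. f u}"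
  have a: "(u \<in> a) \<noteq> (v \<in> a) \<longleftrightarrow> e u v" if "u \<in> F" "v \<in> F" "hex_adj u v" for u v
    using f[OF that] that(1,2) unfolding a_def by simp
  have sub: "a \<subseteq> F" "sym_diff a x \<subseteq> F"
    using x unfolding a_def blue_sets_def cut_within_def by blast+
  have "(u \<in> a) = (v \<in> a) \<or> u \<in> r \<and> v \<in> r" if "u \<in> F" "v \<in> F" "hex_adj u v" for u v
    using a[OF that] unfolding e_def by argo
  then have "a \<in> ?P"
    using sub(1) unfolding cut_within_def by simp
  \<comment> \<open>Adding \<open>a\<close> cancels the changes of \<open>x\<close> across edges
    inside \<open>r\<close>; by coherence the remaining ones have both ends outside
    \<open>r\<close>.\<close>
  moreover have "(u \<in> sym_diff a x) = (v \<in> sym_diff a x) \<or> u \<notin> r \<and> v \<notin> r"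
    if "u \<in> F" "v \<in> F" "hex_adj u v" for u v
    unfolding Un_iff Diff_iff using a[OF that] coh[OF that] unfolding e_def by argo
  then have "sym_diff a x \<in> ?M"
    using sub(2) unfolding cut_within_def by blast
  moreover have "x = sym_diff a (sym_diff a x)"
    by auto
  ultimately show "x \<in> {sym_diff a b | a b. a \<in> ?P \<and> b \<in> ?M}"
    unfolding mem_Collect_eq by metis
qed

lemma card_blue_sets_supermodular:
  assumes "finite F" "cocycles_exact F"
  shows "card (blue_sets F r) * card (blue_sets F s)
    \<le> card (blue_sets F (r \<union> s)) * card (blue_sets F (r \<inter> s))"
proof -
  define p where "p r = card (cut_within F (\<lambda>u v. u \<in> r \<and> v \<in> r))" for r
  define m where "m r = card (cut_within F (\<lambda>u v. u \<notin> r \<and> v \<notin> r))" for r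
  \<comment> \<open>The order of the intersection of the two groups, independent of
    \<open>r\<close>: it consists of the sets that are constant across every edge.\<close>
  define k where "k = card (cut_within F (\<lambda>u v. False))"
  have "{} \<in> cut_within F (\<lambda>u v. False)"
    unfolding cut_within_def by auto
  then have k: "k > 0"
    unfolding k_def using finite_cut_within[OF assms(1)] card_gt_0_iff by blast
  have split: "p r * m r = card (blue_sets F r) * k" for r
  proof -
    have "(\<lambda>u v. (u \<in> r \<and> v \<in> r) \<and> u \<notin> r \<and> v \<notin> r) = (\<lambda>u v. False)"
      by auto
    then show ?thesis
      using card_cut_within_mult[of F "\<lambda>u v. u \<in> r \<and> v \<in> r" "\<lambda>u v. u \<notin> r \<and> v \<notin> r"]
      unfolding blue_sets_split[OF assms(2)] p_def m_def k_def by simp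
  qed
  have "p r * p s \<le> p (r \<union> s) * p (r \<inter> s)"
  proof -
    have "p r * p s \<le> card (cut_within F (\<lambda>u v. (u \<in> r \<and> v \<in> r) \<or> (u \<in> s \<and> v \<in> s)))
        * card (cut_within F (\<lambda>u v. (u \<in> r \<and> v \<in> r) \<and> (u \<in> s \<and> v \<in> s)))"
      unfolding p_def by (rule card_cut_within_supermodular[OF assms(1)])
    also have "\<dots> \<le> p (r \<union> s) * p (r \<inter> s)"
      unfolding p_def
      by (intro mult_mono card_mono finite_cut_within assms cut_within_mono) auto
    finally show ?thesis .
  qed
  \<comment> \<open>Complementation exchanges union and intersection, so the \<open>-\<close> factor
    satisfies the inequality in the same direction as the \<open>+\<close> factor.\<close>
  moreover have "m r * m s \<le> m (r \<inter> s) * m (r \<union> s)"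
  proof -
    have "m r * m s \<le> card (cut_within F (\<lambda>u v. (u \<notin> r \<and> v \<notin> r) \<or> (u \<notin> s \<and> v \<notin> s)))
        * card (cut_within F (\<lambda>u v. (u \<notin> r \<and> v \<notin> r) \<and> (u \<notin> s \<and> v \<notin> s)))"
      unfolding m_def by (rule card_cut_within_supermodular[OF assms(1)])
    also have "\<dots> \<le> m (r \<inter> s) * m (r \<union> s)"
      unfolding m_def
      by (intro mult_mono card_mono finite_cut_within assms cut_within_mono) auto
    finally show ?thesis .
  qed
  ultimately have "(p r * p s) * (m r * m s)
      \<le> (p (r \<union> s) * p (r \<inter> s)) * (m (r \<inter> s) * m (r \<union> s))"
    by (rule mult_mono) auto
  then have "(p r * m r) * (p s * m s)
      \<le> (p (r \<union> s) * m (r \<union> s)) * (p (r \<inter> s) * m (r \<inter> s))"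
    by (simp add: mult_ac)
  then have "(k * k) * (card (blue_sets F r) * card (blue_sets F s))
      \<le> (k * k) * (card (blue_sets F (r \<union> s)) * card (blue_sets F (r \<inter> s)))"
    unfolding split by (simp add: mult_ac)
  with k show ?thesis
    by simp
qed

section \<open>From spin functions to sets of faces\<close>

lemma bij_betw_spins_Pow: "bij_betw (\<lambda>\<sigma>. {f \<in> F. \<sigma> f}) (spins F) (Pow F)"
  by (rule bij_betwI[where g = "\<lambda>S. \<lambda>f\<in>F. f \<in> S"])
     (auto simp: spins_def fun_eq_iff PiE_def extensional_def)

text \<open>Counting by fibres over the red component turns the numerator of \<open>nu\<close> into
  a weighted sum over sets of \<open>+\<close> faces.\<close>

lemma card_coherent_pairs:
  assumes "finite F" "A \<subseteq> spins F"
  shows "card {p \<in> coherent_pairs F. fst p \<in> A}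
    = (\<Sum>r \<in> (\<lambda>\<sigma>. {f \<in> F. \<sigma> f}) ` A. card (blue_sets F r))"
proof -
  let ?\<phi> = "\<lambda>\<sigma>. {f \<in> F. \<sigma> f}"
  have bij: "bij_betw ?\<phi> (spins F) (Pow F)"
    by (rule bij_betw_spins_Pow)
  have fin: "finite (spins F)"
    unfolding spins_def using assms(1) by (intro finite_PiE) auto
  have fiber: "card {b \<in> spins F. (r, b) \<in> coherent_pairs F} = card (blue_sets F (?\<phi> r))"
    if "r \<in> spins F" for r
  proof (rule bij_betw_same_card[of ?\<phi>])
    have "?\<phi> ` {b \<in> spins F. (r, b) \<in> coherent_pairs F} = blue_sets F (?\<phi> r)"
    proof (intro subset_antisym subsetI)
      fix b assume b: "b \<in> blue_sets F (?\<phi> r)"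
      then have "b \<in> Pow F" by (simp add: blue_sets_def cut_within_def)
      then obtain b' where "b' \<in> spins F" "b = ?\<phi> b'"
        using bij unfolding bij_betw_def by blast
      with b that show "b \<in> ?\<phi> ` {b \<in> spins F. (r, b) \<in> coherent_pairs F}"
        by (auto simp: blue_sets_def cut_within_def coherent_pairs_def intro!: imageI)
    qed (auto simp: blue_sets_def cut_within_def coherent_pairs_def)
    with bij show "bij_betw ?\<phi> {b \<in> spins F. (r, b) \<in> coherent_pairs F} (blue_sets F (?\<phi> r))"
      by (auto simp: bij_betw_def intro: inj_on_subset)
  qed
  have "{p \<in> coherent_pairs F. fst p \<in> A}
      = (SIGMA r:A. {b \<in> spins F. (r, b) \<in> coherent_pairs F})"
    by (auto simp: coherent_pairs_def)
  then have "card {p \<in> coherent_pairs F. fst p \<in> A}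
      = (\<Sum>r\<in>A. card {b \<in> spins F. (r, b) \<in> coherent_pairs F})"
    using fin finite_subset[OF assms(2) fin] by simp
  also have "\<dots> = (\<Sum>r\<in>A. card (blue_sets F (?\<phi> r)))"
    using assms(2) by (intro sum.cong fiber) auto
  also have "\<dots> = (\<Sum>r \<in> ?\<phi> ` A. card (blue_sets F r))"
    using inj_on_subset[OF bij_betw_imp_inj_on[OF bij] assms(2)] by (simp add: sum.reindex)
  finally show ?thesis .
qed

theorem nu_fkg:
  assumes "finite F" "cocycles_exact F" "increasing_event F A" "increasing_event F B"
  shows "nu F A * nu F B \<le> nu F (A \<inter> B)"
proof -
  let ?\<phi> = "\<lambda>\<sigma>. {f \<in> F. \<sigma> f}"
  define w where "w r = real (card (blue_sets F r))" for r
  have bij: "bij_betw ?\<phi> (spins F) (Pow F)"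
    by (rule bij_betw_spins_Pow)
  have AB: "A \<subseteq> spins F" "B \<subseteq> spins F"
    using assms(3,4) by (auto simp: increasing_event_def)
  have count: "real (card {p \<in> coherent_pairs F. fst p \<in> C}) = sum w (Pow F \<inter> ?\<phi> ` C)"
    if "C \<subseteq> spins F" for C
  proof -
    have "Pow F \<inter> ?\<phi> ` C = ?\<phi> ` C" by auto
    then show ?thesis
      using card_coherent_pairs[OF assms(1) that] by (simp add: w_def)
  qed
  have "{p \<in> coherent_pairs F. fst p \<in> spins F} = coherent_pairs F"
    by (auto simp: coherent_pairs_def)
  moreover have "Pow F \<inter> ?\<phi> ` spins F = Pow F"
    using bij by (auto simp: bij_betw_def)
  ultimately have total: "real (card (coherent_pairs F)) = sum w (Pow F)"
    using count[of "spins F"] by simp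
  have up: "T \<in> ?\<phi> ` C" if C: "increasing_event F C" and "S \<in> ?\<phi> ` C" "S \<subseteq> T" "T \<subseteq> F" for C S T
  proof -
    obtain \<sigma> where \<sigma>: "\<sigma> \<in> C" "S = ?\<phi> \<sigma>"
      using \<open>S \<in> ?\<phi> ` C\<close> by blast
    obtain \<tau> where \<tau>: "\<tau> \<in> spins F" "T = ?\<phi> \<tau>"
      using bij \<open>T \<subseteq> F\<close> unfolding bij_betw_def by blast
    have "\<forall>f\<in>F. \<sigma> f \<le> \<tau> f"
      using \<open>S \<subseteq> T\<close> \<sigma>(2) \<tau>(2) by auto
    with C \<sigma>(1) \<tau> show ?thesis
      unfolding increasing_event_def by blast
  qed
  have inter: "?\<phi> ` (A \<inter> B) = ?\<phi> ` A \<inter> ?\<phi> ` B"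
    using inj_on_image_Int[OF bij_betw_imp_inj_on[OF bij] AB] .
  have "sum w (Pow F \<inter> ?\<phi> ` A) * sum w (Pow F \<inter> ?\<phi> ` B)
      \<le> sum w (Pow F \<inter> (?\<phi> ` A \<inter> ?\<phi> ` B)) * sum w (Pow F)"
  proof (rule fkg_inequality[OF assms(1)])
    show "w S * w T \<le> w (S \<union> T) * w (S \<inter> T)" for S T
      unfolding w_def using card_blue_sets_supermodular[OF assms(1,2), of S T]
      by (simp flip: of_nat_mult)
  qed (use up assms(3,4) in \<open>auto simp: w_def\<close>)
  moreover have "sum w (Pow F) \<ge> 0"
    by (simp add: w_def sum_nonneg)
  moreover have "A \<inter> B \<subseteq> spins F"
    using AB(1) by blast
  \<comment> \<open>Were the total weight zero, division by zero would give all three values of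
    \<open>nu\<close> the value 0; otherwise denominators are cleared.\<close>
  ultimately show ?thesis
    unfolding nu_def total count[OF AB(1)] count[OF AB(2)] count[OF \<open>A \<inter> B \<subseteq> spins F\<close>] inter
    by (cases "sum w (Pow F) = 0") (simp_all add: divide_simps mult.commute)
qed

section \<open>Exactness for sets of faces without holes\<close>

lemma cocycles_exact_empty: "cocycles_exact {}"
  by (simp add: cocycles_exact_def)

lemma hex_adj_irrefl: "\<not> hex_adj u u"
  by (cases u) (simp add: hex_adj_Pair)

text \<open>The neighbours of \<open>v\<close> in \<open>G\<close> form a cone with apex
  \<open>c\<close>. The edge from \<open>c\<close> to \<open>v\<close> prescribes the potential at
  \<open>v\<close>, and the triangles \<open>n\<close>, \<open>c\<close>, \<open>v\<close> make it
  correct on all other edges at \<open>v\<close>. If \<open>v\<close> has no neighbour in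
  \<open>G\<close>, the condition is vacuous and any value will do.\<close>

lemma cocycles_exact_insert:
  assumes G: "cocycles_exact G" and v: "v \<notin> G"
    and nbrs: "\<And>n. n \<in> G \<Longrightarrow> hex_adj n v \<Longrightarrow> c \<in> G \<and> hex_adj c v \<and> (n = c \<or> hex_adj n c)"
  shows "cocycles_exact (insert v G)"
  unfolding cocycles_exact_def
proof (intro allI impI)
  fix e :: "face \<Rightarrow> face \<Rightarrow> bool"
  assume "\<forall>u\<in>insert v G. \<forall>w\<in>insert v G. hex_adj u w \<longrightarrow> e u w = e w u"
    and "\<forall>u\<in>insert v G. \<forall>w\<in>insert v G. \<forall>x\<in>insert v G. hex_adj u w \<longrightarrow> hex_adj w x \<longrightarrow>
      hex_adj u x \<longrightarrow> e u x = (e u w \<noteq> e w x)"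
  note sym = this(1)[rule_format] and cocycle = this(2)[rule_format]
  obtain f :: "face \<Rightarrow> bool"
    where "\<forall>u\<in>G. \<forall>w\<in>G. hex_adj u w \<longrightarrow> e u w = (f u \<noteq> f w)"
    using cocycles_exactD[OF G sym[OF insertI2 insertI2] cocycle[OF insertI2 insertI2 insertI2]] ..
  note f = this[rule_format]
  define g where "g = f(v := (f c \<noteq> e c v))"
  have main: "e n v = (g n \<noteq> g v)" if n: "n \<in> G" "hex_adj n v" for n
  proof -
    have c: "c \<in> G" "hex_adj c v" "n = c \<or> hex_adj n c"
      using nbrs[OF n] by auto
    have "g n = f n"
      using n v unfolding g_def by auto
    moreover have "e n v = (e n c \<noteq> e c v)" if "hex_adj n c"
      using cocycle[of n c v] n c that by blast
    moreover have "e n c = (f n \<noteq> f c)" if "hex_adj n c"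
      using f n c that by blast
    ultimately show ?thesis
      using c(3) unfolding g_def by auto
  qed
  have "e u w = (g u \<noteq> g w)" if "u \<in> insert v G" "w \<in> insert v G" "hex_adj u w" for u w
  proof (cases "u = v")
    case True
    with that have "w \<in> G" "hex_adj w v"
      using hex_adj_irrefl[of v] hex_adj_sym[of v w] by auto
    then show ?thesis
      using main[of w] sym[OF that] True by auto
  next
    case u: False
    show ?thesis
    proof (cases "w = v")
      case True
      then show ?thesis
        using main[of u] that u by auto
    next
      case False
      then show ?thesis
        using f[of u w] that u unfolding g_def by auto
    qed
  qed
  then show "\<exists>f :: face \<Rightarrow> bool. \<forall>u\<in>insert v G. \<forall>w\<in>insert v G. hex_adj u w \<longrightarrow> e u w = (f u \<noteq> f w)"
    by blast
qed

text \<open>The rectangle is built up row by row, each row from left to right, so that every new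
  face meets the earlier ones in a cone.\<close>

lemma cocycles_exact_rectangle:
  fixes m n :: nat and a b :: int
  shows "cocycles_exact ({a..<a + int m} \<times> {b..<b + int n})"
proof (induction n)
  case 0
  then show ?case by (simp add: cocycles_exact_empty)
next
  case (Suc n)
  let ?row = "\<lambda>i. {a..<a + int m} \<times> {b..<b + int n} \<union> {a..<a + int i} \<times> {b + int n}"
  have "i \<le> m \<Longrightarrow> cocycles_exact (?row i)" for i
  proof (induction i)
    case 0
    then show ?case using Suc.IH by simp
  next
    case (Suc i)
    let ?v = "(a + int i, b + int n)"
    have eq: "?row (Suc i) = insert ?v (?row i)"
      by auto
    \<comment> \<open>The new face has at most three earlier neighbours: to its left, below, and
      below to the right. The one below is adjacent to the other two; in the first row only the left
      one can be present.\<close>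
    define c where "c = (if n = 0 then (a + int i - 1, b + int n) else (a + int i, b + int n - 1))"
    have "cocycles_exact (insert ?v (?row i))"
    proof (rule cocycles_exact_insert[where c = c])
      show "cocycles_exact (?row i)" using Suc by simp
      show "?v \<notin> ?row i" by auto
      show "c \<in> ?row i \<and> hex_adj c ?v \<and> (x = c \<or> hex_adj x c)" if "x \<in> ?row i" "hex_adj x ?v" for x
      proof (cases x)
        case (Pair p q)
        have "i < m"
          using \<open>Suc i \<le> m\<close> by simp
        have "p = a + int i - 1 \<and> q = b + int n \<or>
          int n \<ge> 1 \<and> (p = a + int i \<or> p = a + int i + 1) \<and> q = b + int n - 1"
          using that unfolding Pair hex_adj_Pair Un_iff mem_Times_iff insert_iff empty_iff
            atLeastLessThan_iff fst_conv snd_conv prod.inject by presburger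
        then consider "p = a + int i - 1" "q = b + int n" "n = 0"
          | "n \<noteq> 0" "p = a + int i - 1" "q = b + int n"
          | "n \<noteq> 0" "p = a + int i" "q = b + int n - 1"
          | "n \<noteq> 0" "p = a + int i + 1" "q = b + int n - 1"
          by (metis of_nat_0 not_one_le_zero)
        then show ?thesis
        proof cases
          case 1
          then have "c = x"
            unfolding c_def Pair by simp
          with that show ?thesis
            by simp
        qed (use \<open>i < m\<close> in \<open>simp_all add: Pair c_def hex_adj_Pair\<close>)
      qed
    qed
    then show ?case unfolding eq .
  qed
  from this[of m] have "cocycles_exact (?row m)" by simp
  also have "?row m = {a..<a + int m} \<times> {b..<b + int (Suc n)}"
    by auto
  finally show ?case .
qed

text \<open>The directions are listed counterclockwise, so that the neighbours of a face, indexed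
  modulo 6, form a cycle.\<close>

definition hex_dirs :: "face list" where
  "hex_dirs = [(1,0), (0,1), (-1,1), (-1,0), (0,-1), (1,-1)]"

definition hex_nbr :: "face \<Rightarrow> nat \<Rightarrow> face" where
  "hex_nbr w k = w + hex_dirs ! (k mod 6)"

lemma hex_adj_iff_hex_nbr: "hex_adj w v \<longleftrightarrow> (\<exists>k<6. v = hex_nbr w k)"
proof -
  have "{..<6::nat} = {0, 1, 2, 3, 4, 5}"
    by auto
  then have "hex_nbr w ` {..<6} = {hex_nbr w 0, hex_nbr w 1, hex_nbr w 2, hex_nbr w 3, hex_nbr w 4, hex_nbr w 5}"
    by simp
  then have "hex_adj w v \<longleftrightarrow> v \<in> hex_nbr w ` {..<6}"
    by (cases w; cases v) (simp add: hex_adj_Pair hex_nbr_def hex_dirs_def disj_ac)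
  then show ?thesis
    by auto
qed

lemma hex_adj_add: "hex_adj (w + u) (w + v) \<longleftrightarrow> hex_adj u v"
  unfolding hex_adj_def fst_add snd_add add_diff_cancel_left ..

lemma hex_adj_hex_nbr: "hex_adj w (hex_nbr w k)"
proof -
  have "k mod 6 \<in> {0,1,2,3,4,5}"
    by auto
  then show ?thesis
    by (cases w) (auto simp: hex_adj_Pair hex_nbr_def hex_dirs_def)
qed

lemma hex_nbr_add_6: "hex_nbr w (k + 6) = hex_nbr w k"
  by (simp add: hex_nbr_def)

lemma hex_nbr_mod: "hex_nbr w (k mod 6) = hex_nbr w k"
  by (simp add: hex_nbr_def)

lemma hex_adj_obtain_shift:
  assumes "hex_adj w v"
  obtains i where "i < 6" "v = hex_nbr w (k + i)"
proof -
  obtain j where "v = hex_nbr w j"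
    using assms hex_adj_iff_hex_nbr by blast
  \<comment> \<open>Modulo 6, \<open>5 * k\<close> serves as \<open>- k\<close>, so the shift is
    \<open>j - k\<close> without subtraction on naturals.\<close>
  moreover have "(k + (j + 5 * k) mod 6) mod 6 = j mod 6"
    by presburger
  ultimately have "v = hex_nbr w (k + (j + 5 * k) mod 6)"
    by (metis hex_nbr_mod)
  then show thesis
    using that[of "(j + 5 * k) mod 6"] by simp
qed

text \<open>Five consecutive neighbours form an induced path; the bound \<open>j < 5\<close>
  excludes the adjacent pair of shifts 0 and 5 that closes the cycle. The proof is a finite
  check.\<close>

lemma hex_adj_hex_nbr_iff:
  assumes "i < j" "j < 5"
  shows "hex_adj (hex_nbr w (k + i)) (hex_nbr w (k + j)) \<longleftrightarrow> j = Suc i"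
proof -
  have *: "\<forall>r\<in>{0,1,2,3,4,5}. \<forall>(i, j)\<in>{(0,1),(0,2),(0,3),(0,4),(1,2),(1,3),(1,4),(2,3),(2,4),(3,4)}.
      hex_adj (hex_dirs ! ((r + i) mod 6)) (hex_dirs ! ((r + j) mod 6)) \<longleftrightarrow> j = Suc i"
    by (simp add: hex_adj_def hex_dirs_def)
  have k: "k mod 6 \<in> {0,1,2,3,4,5}"
    by auto
  have "i = 0 \<and> (j = 1 \<or> j = 2 \<or> j = 3 \<or> j = 4) \<or> i = 1 \<and> (j = 2 \<or> j = 3 \<or> j = 4) \<or>
      i = 2 \<and> (j = 3 \<or> j = 4) \<or> i = 3 \<and> j = 4"
    using assms by presburger
  then have ij: "(i, j) \<in> {(0,1),(0,2),(0,3),(0,4),(1,2),(1,3),(1,4),(2,3),(2,4),(3,4)}"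
    unfolding insert_iff prod.inject by argo
  have "hex_adj (hex_dirs ! ((k mod 6 + i) mod 6)) (hex_dirs ! ((k mod 6 + j) mod 6))
      \<longleftrightarrow> j = Suc i"
    using bspec[OF bspec[OF * k] ij] unfolding prod.case .
  then show ?thesis
    unfolding hex_nbr_def hex_adj_add mod_add_left_eq .
qed

text \<open>Along the path a new face has at most one earlier neighbour, its predecessor, which
  serves as the apex of the cone.\<close>

lemma cocycles_exact_hex_nbr_path:
  assumes "i \<le> 5"
  shows "cocycles_exact (G \<inter> (\<lambda>t. hex_nbr w (k + t)) ` {..<i})"
  using assms
proof (induction i)
  case 0
  then show ?case by (simp add: cocycles_exact_empty)
next
  case (Suc i)
  let ?n = "\<lambda>t. hex_nbr w (k + t)"
  let ?N = "G \<inter> ?n ` {..<i}"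
  have IH: "cocycles_exact ?N"
    using Suc by simp
  show ?case
  proof (cases "?n i \<in> G - ?N")
    case True
    have "cocycles_exact (insert (?n i) ?N)"
    proof (rule cocycles_exact_insert[OF IH])
      show "?n i \<notin> ?N" using True by simp
      fix x assume x: "x \<in> ?N" "hex_adj x (?n i)"
      then obtain t where t: "t < i" "x = ?n t"
        by auto
      with x(2) have "i = Suc t"
        using hex_adj_hex_nbr_iff[of t i w k] Suc.prems by simp
      then have "x = ?n (i - 1)"
        using t by simp
      with x show "?n (i - 1) \<in> ?N \<and> hex_adj (?n (i - 1)) (?n i) \<and> (x = ?n (i - 1) \<or> hex_adj x (?n (i - 1)))"
        by simp
    qed
    moreover have "insert (?n i) ?N = G \<inter> ?n ` {..<Suc i}"
      using True by (auto simp: lessThan_Suc)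
    ultimately show ?thesis
      by simp
  next
    case False
    then have "G \<inter> ?n ` {..<Suc i} = ?N"
      by (auto simp: lessThan_Suc)
    with IH show ?thesis
      by simp
  qed
qed

text \<open>The neighbours of \<open>w\<close> other than \<open>w'\<close> form a path, on which any cocycle has a potential; this
  potential prescribes an extension of the cocycle to the edges at \<open>w\<close>.\<close>

lemma cocycles_exact_delete:
  assumes G: "cocycles_exact G" and w: "w \<in> G" "hex_adj w w'" "w' \<notin> G"
  shows "cocycles_exact (G - {w})"
  unfolding cocycles_exact_def
proof (intro allI impI)
  fix e :: "face \<Rightarrow> face \<Rightarrow> bool"
  assume "\<forall>u\<in>G - {w}. \<forall>v\<in>G - {w}. hex_adj u v \<longrightarrow> e u v = e v u"
    and "\<forall>u\<in>G - {w}. \<forall>v\<in>G - {w}. \<forall>x\<in>G - {w}. hex_adj u v \<longrightarrow> hex_adj v x \<longrightarrow>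
      hex_adj u x \<longrightarrow> e u x = (e u v \<noteq> e v x)"
  note sym = this(1)[rule_format] and cocycle = this(2)[rule_format]
  obtain k where k: "w' = hex_nbr w k"
    using w(2) hex_adj_iff_hex_nbr by blast
  define N where "N = G \<inter> (\<lambda>t. hex_nbr w (Suc k + t)) ` {..<5}"
  have N: "v \<in> N" if v: "v \<in> G" "hex_adj w v" for v
  proof -
    obtain i where i: "i < 6" "v = hex_nbr w (Suc k + i)"
      using hex_adj_obtain_shift[OF v(2)] .
    \<comment> \<open>The shift 5 from \<open>Suc k\<close> leads to index \<open>k + 6\<close>,
      that is to \<open>w'\<close>, which is not in \<open>G\<close>.\<close>
    have "i \<noteq> 5"
      using i(2) v(1) w(3) k hex_nbr_add_6[of w k] by (auto simp: numeral_eq_Suc)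
    with i v(1) show ?thesis
      unfolding N_def by auto
  qed
  have N_G: "v \<in> G - {w}" if "v \<in> N" for v
  proof -
    have "hex_adj w v"
      using that hex_adj_hex_nbr[of w] unfolding N_def by auto
    with that hex_adj_irrefl[of w] show ?thesis
      unfolding N_def by blast
  qed
  have exact_N: "cocycles_exact N"
    unfolding N_def by (rule cocycles_exact_hex_nbr_path) simp
  have e_sym_N: "e u v = e v u" if "u \<in> N" "v \<in> N" "hex_adj u v" for u v
    by (rule sym) (use that N_G in auto)
  have e_cocycle_N: "e u x = (e u v \<noteq> e v x)"
    if "u \<in> N" "v \<in> N" "x \<in> N" "hex_adj u v" "hex_adj v x" "hex_adj u x" for u v x
    by (rule cocycle) (use that N_G in auto)
  obtain h :: "face \<Rightarrow> bool"
    where "\<forall>u\<in>N. \<forall>v\<in>N. hex_adj u v \<longrightarrow> e u v = (h u \<noteq> h v)"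
    using cocycles_exactD[OF exact_N e_sym_N e_cocycle_N] ..
  note h = this[rule_format]
  define e' where "e' u v = (if u = w then h v else if v = w then h u else e u v)" for u v
  have e'_sym: "e' u v = e' v u" if "u \<in> G" "v \<in> G" "hex_adj u v" for u v
    using sym[of u v] that unfolding e'_def by auto
  have e'_cocycle: "e' u x = (e' u v \<noteq> e' v x)"
    if "u \<in> G" "v \<in> G" "x \<in> G" "hex_adj u v" "hex_adj v x" "hex_adj u x" for u v x
  proof -
    have *: "hex_adj v u" "hex_adj x v" "hex_adj x u" "u \<noteq> v" "v \<noteq> x" "u \<noteq> x"
      using that hex_adj_sym hex_adj_irrefl by blast+
    consider "u = w" | "v = w" | "x = w" | "u \<noteq> w" "v \<noteq> w" "x \<noteq> w"
      by blast
    then show ?thesis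
    proof cases
      case 1
      with that * N h[of v x] show ?thesis by (auto simp: e'_def)
    next
      case 2
      with that * N h[of u x] show ?thesis by (auto simp: e'_def)
    next
      case 3
      with that * N h[of u v] show ?thesis by (auto simp: e'_def)
    next
      case 4
      with that cocycle[of u v x] show ?thesis by (auto simp: e'_def)
    qed
  qed
  obtain f :: "face \<Rightarrow> bool"
    where "\<forall>u\<in>G. \<forall>v\<in>G. hex_adj u v \<longrightarrow> e' u v = (f u \<noteq> f v)"
    using cocycles_exactD[OF G e'_sym e'_cocycle] ..
  note f = this[rule_format]
  have "e u v = (f u \<noteq> f v)" if "u \<in> G - {w}" "v \<in> G - {w}" "hex_adj u v" for u v
    using f[of u v] that by (auto simp: e'_def)
  then show "\<exists>f :: face \<Rightarrow> bool. \<forall>u\<in>G - {w}. \<forall>v\<in>G - {w}. hex_adj u v \<longrightarrow> e u v = (f u \<noteq> f v)"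
    by blast
qed

text \<open>Delete the superfluous faces of a large rectangle one at a time, each time choosing one that has
  a neighbour outside the current set.\<close>

theorem cocycles_exact_if_no_holes:
  assumes "finite F"
    and no_holes: "\<And>R. finite R \<Longrightarrow> R \<noteq> {} \<Longrightarrow> R \<inter> F = {}
      \<Longrightarrow> \<exists>w\<in>R. \<exists>w'. hex_adj w w' \<and> w' \<notin> R \<union> F"
  shows "cocycles_exact F"
proof -
  have "\<exists>G. finite G \<and> F \<subseteq> G \<and> cocycles_exact G"
  proof -
    define S where "S = fst ` F \<union> snd ` F"
    define M where "M = (\<Sum>s\<in>S. \<bar>s\<bar>)"
    have fin: "finite S"
      unfolding S_def using \<open>finite F\<close> by auto
    have "\<bar>s\<bar> \<le> M" if "s \<in> S" for s
      unfolding M_def using member_le_sum[OF that _ fin, of abs] by simp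
    then have M: "- M \<le> fst x" "fst x \<le> M" "- M \<le> snd x" "snd x \<le> M" if "x \<in> F" for x
      using that unfolding S_def by (auto simp: abs_le_iff) fastforce+
    define n where "n = nat (2 * M + 1)"
    have "F \<subseteq> {-M..<-M + int n} \<times> {-M..<-M + int n}"
      using M by (force simp: n_def)
    then show ?thesis
      by (intro exI[of _ "{-M..<-M + int n} \<times> {-M..<-M + int n}"] conjI cocycles_exact_rectangle) auto
  qed
  then obtain G where G: "finite G" "F \<subseteq> G" "cocycles_exact G"
    by blast
  from G show ?thesis
  proof (induction "card (G - F)" arbitrary: G rule: less_induct)
    case less
    show ?case
    proof (cases "G = F")
      case False
      then have "G - F \<noteq> {}"
        using less.prems by auto
      then obtain w w' where w: "w \<in> G - F" "hex_adj w w'" "w' \<notin> (G - F) \<union> F"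
        using no_holes[of "G - F"] less.prems(1) by (metis Diff_disjoint Int_commute finite_Diff)
      have "card (G - {w} - F) < card (G - F)"
        using less.prems w by (intro psubset_card_mono) auto
      moreover have "cocycles_exact (G - {w})"
        using w less.prems by (intro cocycles_exact_delete) auto
      ultimately show ?thesis
        using less.hyps[of "G - {w}"] less.prems w by blast
    qed (use less.prems in simp)
  qed
qed

section \<open>Hexagons\<close>

text \<open>In the coordinates \<open>lat_A\<close> and \<open>lat_B\<close> all vertices of the hexagonal lattice are integral.\<close>

definition lat_A :: "complex \<Rightarrow> real" where "lat_A z = 2 * Re z"
definition lat_B :: "complex \<Rightarrow> real" where "lat_B z = Re z + sqrt 3 * Im z"

lemma lat_eq_iff: "z = w \<longleftrightarrow> lat_A z = lat_A w \<and> lat_B z = lat_B w"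
  by (auto simp: lat_A_def lat_B_def complex_eq_iff)

lemma sqrt_3_mult: "sqrt 3 * (sqrt 3 * x) = 3 * x" "sqrt 3 * (x * sqrt 3) = 3 * x"
proof -
  show "sqrt 3 * (sqrt 3 * x) = 3 * x"
    by (simp flip: mult.assoc)
  then show "sqrt 3 * (x * sqrt 3) = 3 * x"
    by (simp only: mult.commute[of x])
qed

lemma lat_center:
  "lat_A (center u) = 2 * of_int (fst u) + of_int (snd u)"
  "lat_B (center u) = of_int (fst u) + 2 * of_int (snd u)"
  by (simp_all add: lat_A_def lat_B_def center_def omega_def sqrt_3_mult)

lemma lat_edge_end1:
  "lat_A (edge_end1 u v) = lat_A (center u) + of_int (fst v - fst u)"
  "lat_B (edge_end1 u v) = lat_B (center u) + of_int (fst v - fst u) + of_int (snd v - snd u)"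
  by (simp_all add: lat_A_def lat_B_def edge_end1_def center_def omega_def field_simps sqrt_3_mult)

lemma lat_edge_end2:
  "lat_A (edge_end2 u v) = lat_A (center u) + of_int (fst v - fst u) + of_int (snd v - snd u)"
  "lat_B (edge_end2 u v) = lat_B (center u) + of_int (snd v - snd u)"
  by (simp_all add: lat_A_def lat_B_def edge_end2_def center_def omega_def field_simps sqrt_3_mult)

lemma lat_linear_combination:
  "lat_A ((1 - t) *\<^sub>R z + t *\<^sub>R w) = (1 - t) * lat_A z + t * lat_A w"
  "lat_B ((1 - t) *\<^sub>R z + t *\<^sub>R w) = (1 - t) * lat_B z + t * lat_B w"
  by (simp_all add: lat_A_def lat_B_def algebra_simps)

lemma edge_end_swap: "edge_end1 v u = edge_end2 u v" "edge_end2 v u = edge_end1 u v"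
  unfolding lat_eq_iff lat_edge_end1 lat_edge_end2 lat_center by simp_all

text \<open>\<open>lat_A\<close>, \<open>lat_B\<close> and their difference are twice the
  projections onto the three adjacency directions, so three strips of half-width 1 cut out the
  regular hexagon.\<close>

definition hexagon :: "face \<Rightarrow> complex set" where
  "hexagon f = {z. \<bar>lat_A z - lat_A (center f)\<bar> \<le> 1 \<and> \<bar>lat_B z - lat_B (center f)\<bar> \<le> 1 \<and>
    \<bar>(lat_A z - lat_A (center f)) - (lat_B z - lat_B (center f))\<bar> \<le> 1}"

definition open_hexagon :: "face \<Rightarrow> complex set" where
  "open_hexagon f = {z. \<bar>lat_A z - lat_A (center f)\<bar> < 1 \<and> \<bar>lat_B z - lat_B (center f)\<bar> < 1 \<and>
    \<bar>(lat_A z - lat_A (center f)) - (lat_B z - lat_B (center f))\<bar> < 1}"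

lemma continuous_lat [continuous_intros]: "continuous_on S lat_A" "continuous_on S lat_B"
  unfolding lat_A_def lat_B_def by (intro continuous_intros)+

lemma closed_hexagon: "closed (hexagon f)"
  unfolding hexagon_def by (intro closed_Collect_conj closed_Collect_le continuous_intros)

lemma abs_convex_bound:
  fixes x y t :: real
  assumes "\<bar>x\<bar> \<le> 1" "\<bar>y\<bar> \<le> 1" "0 \<le> t" "t \<le> 1"
  shows "\<bar>(1 - t) * x + t * y\<bar> \<le> 1" "\<bar>x\<bar> < 1 \<Longrightarrow> t < 1 \<Longrightarrow> \<bar>(1 - t) * x + t * y\<bar> < 1"
proof -
  have *: "\<bar>(1 - t) * x + t * y\<bar> \<le> (1 - t) * \<bar>x\<bar> + t * \<bar>y\<bar>"
    using abs_triangle_ineq[of "(1 - t) * x" "t * y"] assms by (simp add: abs_mult)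
  have **: "t * \<bar>y\<bar> \<le> t"
    using assms mult_left_mono[of "\<bar>y\<bar>" 1 t] by simp
  have "(1 - t) * \<bar>x\<bar> \<le> 1 - t"
    using assms mult_left_mono[of "\<bar>x\<bar>" 1 "1 - t"] by simp
  with * ** show "\<bar>(1 - t) * x + t * y\<bar> \<le> 1"
    by linarith
  assume "\<bar>x\<bar> < 1" "t < 1"
  then have "(1 - t) * \<bar>x\<bar> < 1 - t"
    using mult_strict_left_mono[of "\<bar>x\<bar>" 1 "1 - t"] by simp
  with * ** show "\<bar>(1 - t) * x + t * y\<bar> < 1"
    by linarith
qed

lemma hexagon_combination:
  assumes "z \<in> hexagon f" "w \<in> hexagon f" "0 \<le> t" "t \<le> 1"
  shows "(1 - t) *\<^sub>R z + t *\<^sub>R w \<in> hexagon f"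
    and "z \<in> open_hexagon f \<Longrightarrow> t < 1 \<Longrightarrow> (1 - t) *\<^sub>R z + t *\<^sub>R w \<in> open_hexagon f"
proof -
  have eq: "(1 - t) * a + t * b - c = (1 - t) * (a - c) + t * (b - c)"
    "(1 - t) * a + t * b - ((1 - t) * a' + t * b') = (1 - t) * (a - a') + t * (b - b')" for a b c a' b' :: real
    by (simp_all add: algebra_simps)
  show "(1 - t) *\<^sub>R z + t *\<^sub>R w \<in> hexagon f"
    using assms unfolding hexagon_def mem_Collect_eq lat_linear_combination
      eq(1)[of _ _ "lat_A (center f)"] eq(1)[of _ _ "lat_B (center f)"] eq(2)
    by (intro conjI abs_convex_bound(1)) auto
  show "(1 - t) *\<^sub>R z + t *\<^sub>R w \<in> open_hexagon f" if "z \<in> open_hexagon f" "t < 1"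
    using assms that unfolding hexagon_def open_hexagon_def mem_Collect_eq lat_linear_combination
      eq(1)[of _ _ "lat_A (center f)"] eq(1)[of _ _ "lat_B (center f)"] eq(2)
    by (intro conjI abs_convex_bound(2)) auto
qed

lemma convex_hexagon: "convex (hexagon f)"
  unfolding convex_alt using hexagon_combination(1) by blast

lemma open_hexagon_subset: "open_hexagon f \<subseteq> hexagon f"
  unfolding open_hexagon_def hexagon_def by auto

lemma convex_open_hexagon: "convex (open_hexagon f)"
proof -
  have "(1 - t) *\<^sub>R z + t *\<^sub>R w \<in> open_hexagon f"
    if "z \<in> open_hexagon f" "w \<in> open_hexagon f" "0 \<le> t" "t \<le> 1" for z w t
    using that hexagon_combination(2)[of z f w t] open_hexagon_subset[of f] by (cases "t = 1") auto
  then show ?thesis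
    unfolding convex_alt by blast
qed

lemma center_in_open_hexagon: "center f \<in> open_hexagon f"
  by (simp add: open_hexagon_def)

text \<open>The segment from the centre to \<open>z\<close> stays in the open hexagon until it
  reaches \<open>z\<close>.\<close>

lemma hexagon_subset_closure: "hexagon f \<subseteq> closure (open_hexagon f)"
proof
  fix z assume z: "z \<in> hexagon f"
  let ?x = "\<lambda>n. (1 - (1 - 1 / real (Suc n))) *\<^sub>R center f + (1 - 1 / real (Suc n)) *\<^sub>R z"
  have "?x n \<in> open_hexagon f" for n
    using center_in_open_hexagon[of f] open_hexagon_subset[of f] z by (intro hexagon_combination(2)) auto
  moreover have "?x \<longlonglongrightarrow> (1 - (1 - 0)) *\<^sub>R center f + (1 - 0) *\<^sub>R z"
    by (intro tendsto_intros LIMSEQ_Suc[OF lim_const_over_n])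
  ultimately show "z \<in> closure (open_hexagon f)"
    unfolding closure_sequential by (intro exI[of _ ?x]) simp
qed

section \<open>The hexagons tile the plane\<close>

lemma hexagon_iff:
  "z \<in> hexagon (a, b) \<longleftrightarrow>
    2 * of_int a + of_int b - 1 \<le> lat_A z \<and> lat_A z \<le> 2 * of_int a + of_int b + 1 \<and>
    of_int a + 2 * of_int b - 1 \<le> lat_B z \<and> lat_B z \<le> of_int a + 2 * of_int b + 1 \<and>
    of_int a - of_int b - 1 \<le> lat_A z - lat_B z \<and> lat_A z - lat_B z \<le> of_int a - of_int b + 1"
  unfolding hexagon_def mem_Collect_eq lat_center fst_conv snd_conv abs_le_iff by argo

lemma open_hexagon_iff:
  "z \<in> open_hexagon (a, b) \<longleftrightarrow>
    2 * of_int a + of_int b - 1 < lat_A z \<and> lat_A z < 2 * of_int a + of_int b + 1 \<and>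
    of_int a + 2 * of_int b - 1 < lat_B z \<and> lat_B z < of_int a + 2 * of_int b + 1 \<and>
    of_int a - of_int b - 1 < lat_A z - lat_B z \<and> lat_A z - lat_B z < of_int a - of_int b + 1"
  unfolding open_hexagon_def mem_Collect_eq lat_center fst_conv snd_conv abs_less_iff by argo

text \<open>Overlap bounds three integer combinations of the centre difference \<open>(x, y)\<close>
  by 2 in absolute value; the only solutions are zero and the six directions. With strict bounds
  only zero remains, which gives the disjointness of open hexagons below.\<close>

lemma hexagon_Int_imp_adj:
  assumes "z \<in> hexagon f" "z \<in> hexagon g"
  shows "f = g \<or> hex_adj f g"
proof -
  obtain a b c d where f: "f = (a, b)" and g: "g = (c, d)" by fastforce
  define x y where "x = c - a" and "y = d - b"
  have "real_of_int (2 * x + y) \<le> 2" "-2 \<le> real_of_int (2 * x + y)"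
    "real_of_int (x + 2 * y) \<le> 2" "-2 \<le> real_of_int (x + 2 * y)"
    "real_of_int (x - y) \<le> 2" "-2 \<le> real_of_int (x - y)"
    using assms unfolding f g hexagon_iff x_def y_def by simp_all
  then have "2 * x + y \<le> 2" "-2 \<le> 2 * x + y" "x + 2 * y \<le> 2" "-2 \<le> x + 2 * y" "x - y \<le> 2" "-2 \<le> x - y"
    by linarith+
  then have "x = 0 \<and> y = 0 \<or> x = 1 \<and> y = 0 \<or> x = -1 \<and> y = 0 \<or>
    x = 0 \<and> y = 1 \<or> x = 0 \<and> y = -1 \<or> x = 1 \<and> y = -1 \<or> x = -1 \<and> y = 1"
    by presburger
  moreover have "f = g" if "x = 0" "y = 0"
    using that unfolding f g x_def y_def by simp
  moreover have "hex_adj f g \<longleftrightarrow> (x, y) \<in> {(1,0), (-1,0), (0,1), (0,-1), (1,-1), (-1,1)}"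
    unfolding f g hex_adj_def x_def y_def fst_conv snd_conv ..
  ultimately show ?thesis
    unfolding insert_iff empty_iff prod.inject by argo
qed

lemma open_hexagon_disjoint:
  assumes "z \<in> open_hexagon f" "z \<in> hexagon g"
  shows "f = g"
proof -
  obtain a b c d where f: "f = (a, b)" and g: "g = (c, d)" by fastforce
  define x y where "x = c - a" and "y = d - b"
  have "real_of_int (2 * x + y) < 2" "-2 < real_of_int (2 * x + y)"
    "real_of_int (x + 2 * y) < 2" "-2 < real_of_int (x + 2 * y)"
    "real_of_int (x - y) < 2" "-2 < real_of_int (x - y)"
    using assms unfolding f g hexagon_iff open_hexagon_iff x_def y_def by simp_all
  then have "2 * x + y < 2" "-2 < 2 * x + y" "x + 2 * y < 2" "-2 < x + 2 * y" "x - y < 2" "-2 < x - y"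
    by linarith+
  then have "x = 0" "y = 0"
    by presburger+
  then show ?thesis
    unfolding f g x_def y_def by simp
qed

lemma hexagon_cover: "\<exists>f. z \<in> hexagon f"
proof -
  \<comment> \<open>The coordinates of \<open>z\<close> in the basis \<open>1\<close>,
    \<open>omega\<close>; \<open>p\<close> and \<open>q\<close> below are their fractional
    parts.\<close>
  define x y where "x = (2 * lat_A z - lat_B z) / 3" and "y = (2 * lat_B z - lat_A z) / 3"
  define a b where "a = \<lfloor>x\<rfloor>" and "b = \<lfloor>y\<rfloor>"
  define \<alpha> \<beta> where "\<alpha> = real_of_int a" and "\<beta> = real_of_int b"
  define p q where "p = x - \<alpha>" and "q = y - \<beta>"
  have pq: "0 \<le> p" "p < 1" "0 \<le> q" "q < 1"
    unfolding p_def q_def a_def b_def \<alpha>_def \<beta>_def by linarith+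
  have AB: "lat_A z = 2 * \<alpha> + \<beta> + (2 * p + q)" "lat_B z = \<alpha> + 2 * \<beta> + (p + 2 * q)"
    unfolding p_def q_def x_def y_def by (simp_all add: field_simps)
  have shift: "z \<in> hexagon (a + c, b + d)"
    if "\<gamma> = real_of_int c" "\<delta> = real_of_int d" "2 * \<gamma> + \<delta> - 1 \<le> 2 * p + q" "2 * p + q \<le> 2 * \<gamma> + \<delta> + 1"
      "\<gamma> + 2 * \<delta> - 1 \<le> p + 2 * q" "p + 2 * q \<le> \<gamma> + 2 * \<delta> + 1" "\<gamma> - \<delta> - 1 \<le> p - q" "p - q \<le> \<gamma> - \<delta> + 1"
    for c d \<gamma> \<delta>
    unfolding hexagon_iff AB of_int_add that(1,2)[symmetric] \<alpha>_def[symmetric] \<beta>_def[symmetric]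
      distrib_left
    using that(3-) by (intro conjI; linarith)
  \<comment> \<open>The lattice parallelogram containing \<open>z\<close> is covered by the hexagons
    at its corners \<open>(0,0)\<close>, \<open>(1,1)\<close>, \<open>(1,0)\<close> and
    \<open>(0,1)\<close>, in this order.\<close>
  consider "2 * p + q \<le> 1" "p + 2 * q \<le> 1" | "2 * p + q \<ge> 2" "p + 2 * q \<ge> 2"
    | "2 * p + q \<ge> 1" "p + 2 * q \<le> 2" "p \<ge> q" | "2 * p + q \<le> 2" "p + 2 * q \<ge> 1" "p \<le> q"
    by linarith
  then show ?thesis
  proof cases
    case 1
    with pq shift[of 0 0 0 0] show ?thesis by auto
  next
    case 2
    with pq shift[of 1 1 1 1] show ?thesis by auto
  next
    case 3
    with pq shift[of 1 1 0 0] show ?thesis by auto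
  next
    case 4
    with pq shift[of 0 0 1 1] show ?thesis by auto
  qed
qed

lemma finite_hexagons_meeting:
  assumes "bounded S"
  shows "finite {f. hexagon f \<inter> S \<noteq> {}}"
proof -
  obtain M where M: "\<And>z. z \<in> S \<Longrightarrow> norm z \<le> M"
    using assms unfolding bounded_iff by blast
  \<comment> \<open>As \<open>sqrt 3 \<le> 2\<close>, both coordinates of \<open>z\<close> are at
    most \<open>3 * \<bar>M\<bar>\<close> in absolute value, and the centre of a hexagon containing
    \<open>z\<close> differs from it by at most 1 in each.\<close>
  define k where "k = \<lceil>3 * \<bar>M\<bar> + 1\<rceil>"
  have "{f. hexagon f \<inter> S \<noteq> {}} \<subseteq> {-k..k} \<times> {-k..k}"
  proof (rule subrelI)
    fix a b assume "(a, b) \<in> {f. hexagon f \<inter> S \<noteq> {}}"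
    then obtain z where z: "z \<in> hexagon (a, b)" "z \<in> S"
      by blast
    have "\<bar>Re z\<bar> \<le> M" "\<bar>Im z\<bar> \<le> M"
      using M[OF z(2)] abs_Re_le_cmod[of z] abs_Im_le_cmod[of z] by linarith+
    moreover have "\<bar>sqrt 3 * Im z\<bar> \<le> 2 * \<bar>Im z\<bar>"
      unfolding abs_mult by (intro mult_right_mono) (auto intro: real_le_lsqrt)
    ultimately have "\<bar>lat_A z\<bar> \<le> 3 * \<bar>M\<bar>" "\<bar>lat_B z\<bar> \<le> 3 * \<bar>M\<bar>"
      unfolding lat_A_def lat_B_def by linarith+
    moreover have "3 * \<bar>M\<bar> + 1 \<le> of_int k"
      unfolding k_def by linarith
    ultimately have "real_of_int (2 * a + b) \<le> of_int k" "real_of_int (- k) \<le> of_int (2 * a + b)"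
      "real_of_int (a + 2 * b) \<le> of_int k" "real_of_int (- k) \<le> of_int (a + 2 * b)"
      using z(1) unfolding hexagon_iff abs_le_iff of_int_add of_int_mult of_int_minus of_int_numeral
      by linarith+
    then have "2 * a + b \<le> k" "- k \<le> 2 * a + b" "a + 2 * b \<le> k" "- k \<le> a + 2 * b"
      unfolding of_int_le_iff .
    then have "- k \<le> a" "a \<le> k" "- k \<le> b" "b \<le> k"
      by linarith+
    then show "(a, b) \<in> {-k..k} \<times> {-k..k}"
      by simp
  qed
  then show ?thesis
    by (rule finite_subset) auto
qed

lemma bounded_hexagon: "bounded (hexagon f)"
proof -
  have "norm z \<le> \<bar>lat_A (center f)\<bar> + \<bar>lat_B (center f)\<bar> + 2" if "z \<in> hexagon f" for z
  proof -
    have "\<bar>Im z\<bar> \<le> \<bar>sqrt 3 * Im z\<bar>"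
      unfolding abs_mult using mult_right_mono[of 1 "\<bar>sqrt 3\<bar>" "\<bar>Im z\<bar>"] by simp
    then have "\<bar>Re z\<bar> + \<bar>Im z\<bar> \<le> \<bar>lat_A z\<bar> + \<bar>lat_B z\<bar>"
      unfolding lat_A_def lat_B_def by linarith
    moreover have "\<bar>lat_A z\<bar> + \<bar>lat_B z\<bar> \<le> \<bar>lat_A (center f)\<bar> + \<bar>lat_B (center f)\<bar> + 2"
      using that unfolding hexagon_def mem_Collect_eq by linarith
    ultimately show ?thesis
      using cmod_le[of z] by linarith
  qed
  then show ?thesis
    unfolding bounded_iff by blast
qed

section \<open>Edges as common sides of hexagons\<close>

lemma hex_adj_cases:
  assumes "hex_adj u v"
  obtains "fst v - fst u = 1" "snd v - snd u = 0" | "fst v - fst u = -1" "snd v - snd u = 0"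
    | "fst v - fst u = 0" "snd v - snd u = 1" | "fst v - fst u = 0" "snd v - snd u = -1"
    | "fst v - fst u = 1" "snd v - snd u = -1" | "fst v - fst u = -1" "snd v - snd u = 1"
  using assms unfolding hex_adj_def insert_iff empty_iff prod.inject by argo

lemma lat_center_diff:
  "lat_A (center v) = lat_A (center u) + (2 * of_int (fst v - fst u) + of_int (snd v - snd u))"
  "lat_B (center v) = lat_B (center u) + (of_int (fst v - fst u) + 2 * of_int (snd v - snd u))"
  by (simp_all add: lat_center)

lemma edge_ends_in_hexagon:
  assumes "hex_adj u v"
  shows "edge_end1 u v \<in> hexagon u" "edge_end2 u v \<in> hexagon u"
  by (rule hex_adj_cases[OF assms]; simp add: hexagon_def lat_edge_end1 lat_edge_end2)+

lemma hexagon_Int_eq_edge: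
  assumes "hex_adj u v"
  shows "hexagon u \<inter> hexagon v = closed_segment (edge_end1 u v) (edge_end2 u v)"
proof (intro subset_antisym subsetI)
  fix z assume "z \<in> closed_segment (edge_end1 u v) (edge_end2 u v)"
  moreover have "closed_segment (edge_end1 u v) (edge_end2 u v) \<subseteq> hexagon u"
    by (intro closed_segment_subset edge_ends_in_hexagon assms convex_hexagon)
  moreover have "closed_segment (edge_end2 v u) (edge_end1 v u) \<subseteq> hexagon v"
    using assms hex_adj_sym by (intro closed_segment_subset edge_ends_in_hexagon convex_hexagon) auto
  ultimately show "z \<in> hexagon u \<inter> hexagon v"
    unfolding edge_end_swap[of v u] by blast
next
  fix z assume z: "z \<in> hexagon u \<inter> hexagon v"
  define \<alpha> \<beta> where "\<alpha> = lat_A z - lat_A (center u)" and "\<beta> = lat_B z - lat_B (center u)"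
  define x y where "x = real_of_int (fst v - fst u)" and "y = real_of_int (snd v - snd u)"
  have *: "\<bar>\<alpha>\<bar> \<le> 1" "\<bar>\<beta>\<bar> \<le> 1" "\<bar>\<alpha> - \<beta>\<bar> \<le> 1" "\<bar>\<alpha> - 2 * x - y\<bar> \<le> 1" "\<bar>\<beta> - x - 2 * y\<bar> \<le> 1" "\<bar>\<alpha> - \<beta> - (x - y)\<bar> \<le> 1"
    using z unfolding hexagon_def \<alpha>_def \<beta>_def x_def y_def lat_center_diff[of v u] by (auto simp: algebra_simps)
  \<comment> \<open>In each direction \<open>t\<close> is solved from an equation in which its
    coefficient is not zero.\<close>
  have "\<exists>t\<in>{0..1}. \<alpha> = x + t * y \<and> \<beta> = x + y - t * x"
  proof (rule hex_adj_cases[OF assms])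
    assume "fst v - fst u = 1" "snd v - snd u = 0"
    then have xy: "x = 1" "y = 0" by (simp_all add: x_def y_def)
    show ?thesis
      by (rule bexI[of _ "1 - \<beta>"]) (use * in \<open>auto simp: xy\<close>)
  next
    assume "fst v - fst u = -1" "snd v - snd u = 0"
    then have xy: "x = -1" "y = 0" by (simp_all add: x_def y_def)
    show ?thesis
      by (rule bexI[of _ "1 + \<beta>"]) (use * in \<open>auto simp: xy\<close>)
  next
    assume "fst v - fst u = 0" "snd v - snd u = 1"
    then have xy: "x = 0" "y = 1" by (simp_all add: x_def y_def)
    show ?thesis
      by (rule bexI[of _ "\<alpha>"]) (use * in \<open>auto simp: xy\<close>)
  next
    assume "fst v - fst u = 0" "snd v - snd u = -1"
    then have xy: "x = 0" "y = -1" by (simp_all add: x_def y_def)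
    show ?thesis
      by (rule bexI[of _ "-\<alpha>"]) (use * in \<open>auto simp: xy\<close>)
  next
    assume "fst v - fst u = 1" "snd v - snd u = -1"
    then have xy: "x = 1" "y = -1" by (simp_all add: x_def y_def)
    show ?thesis
      by (rule bexI[of _ "-\<beta>"]) (use * in \<open>auto simp: xy\<close>)
  next
    assume "fst v - fst u = -1" "snd v - snd u = 1"
    then have xy: "x = -1" "y = 1" by (simp_all add: x_def y_def)
    show ?thesis
      by (rule bexI[of _ "\<beta>"]) (use * in \<open>auto simp: xy\<close>)
  qed
  then obtain t where t: "0 \<le> t" "t \<le> 1" "\<alpha> = x + t * y" "\<beta> = x + y - t * x"
    by auto
  have "z = (1 - t) *\<^sub>R edge_end1 u v + t *\<^sub>R edge_end2 u v"
    unfolding lat_eq_iff lat_linear_combination lat_edge_end1 lat_edge_end2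
    using t(3,4) unfolding \<alpha>_def \<beta>_def x_def y_def by (simp add: algebra_simps)
  with t(1,2) show "z \<in> closed_segment (edge_end1 u v) (edge_end2 u v)"
    unfolding closed_segment_def by blast
qed

lemma edge_ends_distinct:
  assumes "hex_adj u v"
  shows "edge_end1 u v \<noteq> edge_end2 u v"
  by (rule hex_adj_cases[OF assms]; simp add: lat_eq_iff lat_edge_end1 lat_edge_end2)

text \<open>Only at its two ends does an edge meet a third hexagon. Any \<open>h\<close> through
  \<open>z\<close> is a neighbour of \<open>u\<close>, which leaves finitely many pairs of
  directions to compare.\<close>

lemma open_edge_hexagons:
  assumes uv: "hex_adj u v" and z: "z \<in> open_segment (edge_end1 u v) (edge_end2 u v)" "z \<in> hexagon h"
  shows "h = u \<or> h = v"
proof (rule ccontr)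
  assume h: "\<not> ?thesis"
  obtain t where t: "0 < t" "t < 1" "z = (1 - t) *\<^sub>R edge_end1 u v + t *\<^sub>R edge_end2 u v"
    using z(1) unfolding in_segment by blast
  have "z \<in> hexagon u"
    using z(1) hexagon_Int_eq_edge[OF uv] segment_open_subset_closed by blast
  with z(2) h have uh: "hex_adj u h"
    using hexagon_Int_imp_adj by blast
  define \<alpha> \<beta> where "\<alpha> = lat_A z - lat_A (center u)" and "\<beta> = lat_B z - lat_B (center u)"
  define x y where "x = real_of_int (fst v - fst u)" and "y = real_of_int (snd v - snd u)"
  define c d where "c = real_of_int (fst h - fst u)" and "d = real_of_int (snd h - snd u)"
  have xycd: "x = c \<and> y = d \<Longrightarrow> h = v"
    unfolding x_def y_def c_def d_def by (simp add: prod_eq_iff)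
  have "(x, y) \<in> {(1,0), (-1,0), (0,1), (0,-1), (1,-1), (-1,1)}"
    unfolding x_def y_def by (rule hex_adj_cases[OF uv]; simp)
  moreover have "(c, d) \<in> {(1,0), (-1,0), (0,1), (0,-1), (1,-1), (-1,1)}"
    unfolding c_def d_def by (rule hex_adj_cases[OF uh]; simp)
  moreover have "\<alpha> = x + t * y" "\<beta> = x + y - t * x"
    unfolding \<alpha>_def \<beta>_def x_def y_def t(3) lat_linear_combination lat_edge_end1 lat_edge_end2
    by (simp_all add: algebra_simps)
  moreover have "\<bar>\<alpha> - 2 * c - d\<bar> \<le> 1" "\<bar>\<beta> - c - 2 * d\<bar> \<le> 1" "\<bar>\<alpha> - \<beta> - (c - d)\<bar> \<le> 1"
    using z(2) unfolding hexagon_def \<alpha>_def \<beta>_def c_def d_def lat_center_diff[of h u] by (auto simp: algebra_simps)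
  ultimately have "x = c \<and> y = d"
    using t(1,2) unfolding insert_iff empty_iff prod.inject
    by (elim disjE conjE; simp)
  with xycd h show False
    by blast
qed

lemma next_edge_at_hexagon:
  assumes "hex_adj u v"
  shows "\<exists>v'. hex_adj u v' \<and> v' \<noteq> v \<and> edge_end1 u v = edge_end2 u v'"
    and "\<exists>v'. hex_adj u v' \<and> v' \<noteq> v \<and> edge_end2 u v = edge_end1 u v'"
proof -
  obtain a b where u: "u = (a, b)" by fastforce
  define x y where "x = fst v - a" and "y = snd v - b"
  have v: "v = (a + x, b + y)"
    by (simp add: x_def y_def)
  have xy: "(x, y) \<in> {(1,0), (-1,0), (0,1), (0,-1), (1,-1), (-1,1)}"
    using assms unfolding hex_adj_def x_def y_def u fst_conv snd_conv .
  \<comment> \<open>Multiplying \<open>x + y * omega\<close> by \<open>omega\<close> or by its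
    conjugate rotates the direction by 60 degrees to \<open>(- y, x + y)\<close> or
    \<open>(x + y, - x)\<close>; these lead to the neighbours across the adjacent sides.\<close>
  have "hex_adj u (a - y, b + (x + y))" "hex_adj u (a + (x + y), b - x)"
    "(a - y, b + (x + y)) \<noteq> v" "(a + (x + y), b - x) \<noteq> v"
    using xy unfolding hex_adj_def u v by auto
  moreover have "edge_end1 u v = edge_end2 u (a - y, b + (x + y))"
    "edge_end2 u v = edge_end1 u (a + (x + y), b - x)"
    unfolding lat_eq_iff lat_edge_end1 lat_edge_end2 u v by simp_all
  ultimately show "\<exists>v'. hex_adj u v' \<and> v' \<noteq> v \<and> edge_end1 u v = edge_end2 u v'"
    "\<exists>v'. hex_adj u v' \<and> v' \<noteq> v \<and> edge_end2 u v = edge_end1 u v'"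
    by blast+
qed

section \<open>The faces of a domain\<close>

text \<open>End points are compared as unordered pairs because the polygon may traverse an edge in
  either direction.\<close>

definition separates :: "complex list \<Rightarrow> nat \<Rightarrow> face \<Rightarrow> face \<Rightarrow> bool" where
  "separates ps i u v \<longleftrightarrow> i < length ps \<and> hex_adj u v \<and>
     {ps ! i, ps ! ((i + 1) mod length ps)} = {edge_end1 u v, edge_end2 u v}"

lemma separates_segment:
  assumes "separates ps i u v"
  shows "closed_segment (ps ! i) (ps ! ((i + 1) mod length ps)) = hexagon u \<inter> hexagon v"
  using assms hexagon_Int_eq_edge[of u v] unfolding separates_def doubleton_eq_iff
  by (metis closed_segment_commute)

lemma separates_sym: "separates ps i u v \<Longrightarrow> separates ps i v u"
  unfolding separates_def edge_end_swap[of u v] by (metis edge_end_swap hex_adj_sym insert_commute)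

text \<open>An interior point of an edge lies in exactly two hexagons, so it determines
  them.\<close>

lemma separates_unique:
  assumes "separates ps i u v" "separates ps i u' v'"
  shows "{u, v} = {u', v'}"
proof -
  have uv: "hex_adj u v" and uv': "hex_adj u' v'"
    using assms by (auto simp: separates_def)
  obtain z where z: "z \<in> open_segment (edge_end1 u v) (edge_end2 u v)"
    using edge_ends_distinct[OF uv] open_segment_eq_empty by blast
  then have "z \<in> hexagon u \<inter> hexagon v"
    using hexagon_Int_eq_edge[OF uv] segment_open_subset_closed by blast
  then have "z \<in> hexagon u' \<inter> hexagon v'"
    using separates_segment[OF assms(1)] separates_segment[OF assms(2)] by blast
  then have "u' = u \<or> u' = v" "v' = u \<or> v' = v"
    using open_edge_hexagons[OF uv z] by blast+
  moreover have "u' \<noteq> v'"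
    using uv' hex_adj_irrefl by blast
  ultimately show ?thesis
    by blast
qed

lemma polygon_trace_eq:
  assumes "self_avoiding_polygon ps"
  shows "polygon_trace ps = (\<Union>{hexagon u \<inter> hexagon v | u v i. separates ps i u v})"
proof (intro subset_antisym subsetI)
  fix z assume "z \<in> polygon_trace ps"
  then obtain i where i: "i < length ps" "z \<in> closed_segment (ps ! i) (ps ! ((i + 1) mod length ps))"
    unfolding polygon_trace_def by blast
  then obtain u v where "separates ps i u v"
    using assms unfolding self_avoiding_polygon_def H_edge_def separates_def by blast
  with i separates_segment show "z \<in> \<Union>{hexagon u \<inter> hexagon v | u v i. separates ps i u v}"
    by blast
next
  fix z assume "z \<in> \<Union>{hexagon u \<inter> hexagon v | u v i. separates ps i u v}"
  then obtain u v i where "separates ps i u v" "z \<in> hexagon u \<inter> hexagon v"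
    by blast
  then show "z \<in> polygon_trace ps"
    using separates_segment[of ps i u v] unfolding polygon_trace_def separates_def by blast
qed

lemma compact_polygon_trace: "compact (polygon_trace ps)"
  unfolding polygon_trace_def by (intro compact_UN) auto

text \<open>At each vertex of the hexagon exactly two of its sides meet, so a self-avoiding polygon that
  traverses all six sides has to traverse them consecutively and can never leave the hexagon.\<close>

lemma polygon_trace_subset_hexagon:
  assumes ps: "self_avoiding_polygon ps"
    and all: "\<And>v. hex_adj g v \<Longrightarrow> \<exists>i. separates ps i g v"
  shows "polygon_trace ps \<subseteq> hexagon g"
proof -
  let ?n = "length ps"
  define side where "side i \<longleftrightarrow> (\<exists>v. separates ps i g v)" for i
  have n: "?n > 0" and dist: "distinct ps"
    using ps by (auto simp: self_avoiding_polygon_def)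
  have next_side: "side ((i + 1) mod ?n)" if "side i" for i
  proof -
    obtain v where v: "separates ps i g v"
      using \<open>side i\<close> unfolding side_def by blast
    define p where "p = ps ! ((i + 1) mod ?n)"
    have i: "i < ?n" "hex_adj g v" and "p \<in> {edge_end1 g v, edge_end2 g v}"
      using v unfolding separates_def p_def by blast+
    then obtain v' where v': "hex_adj g v'" "v' \<noteq> v" "p \<in> {edge_end1 g v', edge_end2 g v'}"
      using next_edge_at_hexagon[OF i(2)] by blast
    obtain j where j: "separates ps j g v'"
      using all[OF v'(1)] by blast
    then have jn: "j < ?n" and "p \<in> {ps ! j, ps ! ((j + 1) mod ?n)}"
      using v'(3) unfolding separates_def by blast+
    \<comment> \<open>Side \<open>j\<close> either starts at \<open>p\<close> and is the successor
      of side \<open>i\<close>, or ends at \<open>p\<close> and is side \<open>i\<close> itself,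
      contrary to \<open>v' \<noteq> v\<close>.\<close>
    then consider "ps ! j = ps ! ((i + 1) mod ?n)" | "ps ! ((j + 1) mod ?n) = ps ! ((i + 1) mod ?n)"
      unfolding p_def by auto
    then show ?thesis
    proof cases
      case 1
      then have "j = (i + 1) mod ?n"
        using nth_eq_iff_index_eq[OF dist jn mod_less_divisor[OF n]] by simp
      with j show ?thesis
        unfolding side_def by blast
    next
      case 2
      then have "(j + 1) mod ?n = (i + 1) mod ?n"
        using nth_eq_iff_index_eq[OF dist mod_less_divisor[OF n] mod_less_divisor[OF n]] by simp
      then have "j = i"
        using i(1) jn by (auto simp: mod_Suc split: if_splits)
      with separates_unique[OF v] j have "{g, v} = {g, v'}"
        by blast
      with v'(2) show ?thesis
        by (auto simp: doubleton_eq_iff)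
    qed
  qed
  have "hex_adj g (g + (1, 0))"
    unfolding hex_adj_def by simp
  then obtain i0 where i0: "side i0" "i0 < ?n"
    using all unfolding side_def separates_def by blast
  have walk: "side ((i0 + k) mod ?n)" for k
  proof (induction k)
    case 0
    then show ?case using i0 by simp
  next
    case (Suc k)
    then show ?case
      using next_side[OF Suc] by (simp add: mod_simps)
  qed
  show ?thesis
  proof
    fix z assume "z \<in> polygon_trace ps"
    then obtain i where i: "i < ?n" "z \<in> closed_segment (ps ! i) (ps ! ((i + 1) mod ?n))"
      unfolding polygon_trace_def by blast
    have "side i"
      using walk[of "?n - i0 + i"] i(1) i0(2) by simp
    with i separates_segment show "z \<in> hexagon g"
      unfolding side_def by blast
  qed
qed

section \<open>The interior and the exterior of the polygon\<close>

lemma open_hexagon_Int_polygon_trace: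
  assumes "self_avoiding_polygon ps"
  shows "open_hexagon f \<inter> polygon_trace ps = {}"
proof -
  have False if "z \<in> open_hexagon f" "separates ps i u v" "z \<in> hexagon u" "z \<in> hexagon v" for z i u v
    using open_hexagon_disjoint[OF that(1,3)] open_hexagon_disjoint[OF that(1,4)] that(2)
      hex_adj_irrefl[of f] unfolding separates_def by auto
  then show ?thesis
    unfolding polygon_trace_eq[OF assms] by blast
qed

text \<open>The hexagon without the polygon lies between the connected open hexagon and its closure,
  hence is connected and cannot meet both of two disjoint open sets.\<close>

lemma hexagon_inside_or_outside:
  assumes "self_avoiding_polygon ps"
  shows "hexagon f - polygon_trace ps \<subseteq> inside (polygon_trace ps) \<or>
    hexagon f - polygon_trace ps \<subseteq> outside (polygon_trace ps)"
proof -
  let ?T = "polygon_trace ps" and ?C = "hexagon f - polygon_trace ps"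
  have T: "closed ?T"
    using compact_polygon_trace compact_imp_closed by blast
  have "connected ?C"
  proof (rule connected_intermediate_closure[OF convex_connected[OF convex_open_hexagon[of f]]])
    show "open_hexagon f \<subseteq> ?C"
      using open_hexagon_subset open_hexagon_Int_polygon_trace[OF assms] by blast
    show "?C \<subseteq> closure (open_hexagon f)"
      using hexagon_subset_closure by blast
  qed
  moreover have "?C \<subseteq> inside ?T \<union> outside ?T"
    by auto
  ultimately have "inside ?T \<inter> ?C = {} \<or> outside ?T \<inter> ?C = {}"
    by (intro connectedD open_inside open_outside T) auto
  with \<open>?C \<subseteq> inside ?T \<union> outside ?T\<close> show ?thesis
    by blast
qed

lemma hexagon_center_notin_polygon_trace:
  assumes "self_avoiding_polygon ps"
  shows "center f \<in> hexagon f - polygon_trace ps"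
  using center_in_open_hexagon open_hexagon_subset open_hexagon_Int_polygon_trace[OF assms] by blast

lemma dom_edges_sym: "(u, v) \<in> dom_edges ps \<Longrightarrow> (v, u) \<in> dom_edges ps"
  unfolding dom_edges_def mem_Collect_eq prod.case edge_end_swap[of v u]
  using hex_adj_sym[of u v] open_segment_commute[of "edge_end1 u v"] by simp

lemma dom_facesE:
  assumes "f \<in> dom_faces ps"
  obtains v where "(f, v) \<in> dom_edges ps"
  using assms dom_edges_sym unfolding dom_faces_def by blast

lemma dom_edges_open_segment:
  assumes "(u, v) \<in> dom_edges ps"
  obtains z where "z \<in> open_segment (edge_end1 u v) (edge_end2 u v)" "z \<in> hexagon u" "z \<in> hexagon v"
    "z \<in> inside (polygon_trace ps)"
proof -
  have uv: "hex_adj u v" "open_segment (edge_end1 u v) (edge_end2 u v) \<subseteq> inside (polygon_trace ps)"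
    using assms by (auto simp: dom_edges_def)
  obtain z where "z \<in> open_segment (edge_end1 u v) (edge_end2 u v)"
    using edge_ends_distinct[OF uv(1)] open_segment_eq_empty by blast
  then show thesis
    using that uv hexagon_Int_eq_edge segment_open_subset_closed by blast
qed

lemma dom_faces_inside:
  assumes "self_avoiding_polygon ps" "f \<in> dom_faces ps"
  shows "hexagon f - polygon_trace ps \<subseteq> inside (polygon_trace ps)"
proof -
  obtain v where "(f, v) \<in> dom_edges ps"
    using assms(2) by (rule dom_facesE)
  then obtain z where "z \<in> hexagon f" "z \<in> inside (polygon_trace ps)"
    by (rule dom_edges_open_segment)
  then have "z \<in> hexagon f - polygon_trace ps" "z \<notin> outside (polygon_trace ps)"
    using inside_no_overlap[of "polygon_trace ps"] inside_Int_outside[of "polygon_trace ps"] by blast+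
  then show ?thesis
    using hexagon_inside_or_outside[OF assms(1), of f] by blast
qed

lemma finite_dom_faces:
  assumes "self_avoiding_polygon ps"
  shows "finite (dom_faces ps)"
proof -
  have "hexagon f \<inter> inside (polygon_trace ps) \<noteq> {}" if "f \<in> dom_faces ps" for f
    using dom_faces_inside[OF assms that] hexagon_center_notin_polygon_trace[OF assms, of f] by blast
  moreover have "finite {f. hexagon f \<inter> inside (polygon_trace ps) \<noteq> {}}"
    using compact_polygon_trace compact_imp_bounded
    by (intro finite_hexagons_meeting bounded_inside) blast
  ultimately show ?thesis
    by (metis (mono_tags, lifting) finite_subset mem_Collect_eq subsetI)
qed

text \<open>If such a hexagon were inside, the polygon would run along all of its sides and hence coincide
  with its boundary, leaving no room for the given face.\<close>

lemma not_dom_face_outside: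
  assumes ps: "self_avoiding_polygon ps" and ne: "dom_faces ps \<noteq> {}" and g: "g \<notin> dom_faces ps"
  shows "hexagon g - polygon_trace ps \<subseteq> outside (polygon_trace ps)"
proof (rule ccontr)
  let ?T = "polygon_trace ps"
  assume "\<not> ?thesis"
  then have inside: "hexagon g - ?T \<subseteq> inside ?T"
    using hexagon_inside_or_outside[OF ps, of g] by blast
  have "\<exists>i. separates ps i g v" if v: "hex_adj g v" for v
  proof -
    have "(g, v) \<notin> dom_edges ps"
      using g unfolding dom_faces_def by auto
    then obtain z where z: "z \<in> open_segment (edge_end1 g v) (edge_end2 g v)" "z \<notin> inside ?T"
      using v unfolding dom_edges_def by blast
    then have "z \<in> hexagon g"
      using hexagon_Int_eq_edge[OF v] segment_open_subset_closed by blast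
    with z(2) inside have "z \<in> ?T"
      by blast
    then obtain i a b where i: "separates ps i a b" "z \<in> hexagon a" "z \<in> hexagon b"
      unfolding polygon_trace_eq[OF ps] by blast
    then have "a = g \<or> a = v" "b = g \<or> b = v" "a \<noteq> b"
      using open_edge_hexagons[OF v z(1)] hex_adj_irrefl unfolding separates_def by blast+
    with i(1) separates_sym show ?thesis
      by blast
  qed
  then have "?T \<subseteq> hexagon g"
    by (rule polygon_trace_subset_hexagon[OF ps])
  \<comment> \<open>The complement of a convex set containing the polygon lies in the
    exterior.\<close>
  then have sub: "inside ?T \<subseteq> hexagon g"
    using outside_subset_convex[OF convex_hexagon] inside_Int_outside[of ?T] by blast
  obtain a b where ab: "(a, b) \<in> dom_edges ps"
    using ne dom_facesE by blast
  then obtain z where "z \<in> open_segment (edge_end1 a b) (edge_end2 a b)" "z \<in> inside ?T"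
    by (rule dom_edges_open_segment)
  then have "g = a \<or> g = b"
    using sub ab open_edge_hexagons[of a b z g] unfolding dom_edges_def by blast
  with g ab show False
    unfolding dom_faces_def by blast
qed

lemma dom_faces_no_holes:
  assumes ps: "self_avoiding_polygon ps" and ne: "dom_faces ps \<noteq> {}"
    and R: "finite R" "R \<noteq> {}" "R \<inter> dom_faces ps = {}"
  shows "\<exists>w\<in>R. \<exists>w'. hex_adj w w' \<and> w' \<notin> R \<union> dom_faces ps"
proof (rule ccontr)
  assume no_exit: "\<not> ?thesis"
  let ?T = "polygon_trace ps"
  define K where "K = (\<Union>f\<in>R. hexagon f)"
  have T: "bounded ?T" "closed ?T"
    using compact_polygon_trace compact_imp_bounded compact_imp_closed by blast+
  have "bounded K"
    unfolding K_def using R(1) bounded_hexagon by auto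
  obtain g where g: "g \<in> R"
    using R(2) by blast
  have "center g \<in> outside ?T \<inter> K"
    using not_dom_face_outside[OF ps ne, of g] hexagon_center_notin_polygon_trace[OF ps, of g] g R(3)
    unfolding K_def by blast
  moreover have "\<not> outside ?T \<subseteq> K"
    using \<open>bounded K\<close> unbounded_outside[OF T(1)] bounded_subset by blast
  \<comment> \<open>The dimension of the plane enters here: the exterior of a bounded set is
    connected in dimension at least 2.\<close>
  moreover have "connected (outside ?T)"
    by (rule connected_outside[OF T(1)]) simp
  ultimately obtain z where z: "z \<in> outside ?T" "z \<in> frontier K"
    using connected_Int_frontier[of "outside ?T" K] by blast
  have "closed K"
    unfolding K_def using R(1) closed_hexagon by (intro closed_UN) auto
  then have "z \<in> K"
    using z(2) frontier_subset_closed by blast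
  then obtain f where f: "f \<in> R" "z \<in> hexagon f"
    unfolding K_def by blast
  have around: "h \<in> R" if "z \<in> hexagon h" for h
  proof -
    have "z \<notin> ?T" "z \<notin> inside ?T"
      using z(1) outside_no_overlap[of ?T] inside_Int_outside[of ?T] by blast+
    then have "h \<notin> dom_faces ps"
      using dom_faces_inside[OF ps, of h] that by blast
    moreover have "h = f \<or> hex_adj f h"
      using hexagon_Int_imp_adj[OF f(2) that] by blast
    ultimately show ?thesis
      using no_exit f(1) by blast
  qed
  \<comment> \<open>Local finiteness: only finitely many hexagons outside \<open>R\<close> come near
    \<open>z\<close>, and none contains it. Removing them from the ball leaves a neighbourhood of
    \<open>z\<close> covered by \<open>R\<close>.\<close>
  define N where "N = {h. hexagon h \<inter> ball z 1 \<noteq> {}} - R"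
  have "finite N"
    unfolding N_def using finite_hexagons_meeting[OF bounded_ball] by blast
  then have "open (ball z 1 - (\<Union>h\<in>N. hexagon h))"
    using closed_hexagon by (intro open_Diff closed_UN) auto
  moreover have "z \<in> ball z 1 - (\<Union>h\<in>N. hexagon h)"
    using around unfolding N_def by auto
  moreover have "ball z 1 - (\<Union>h\<in>N. hexagon h) \<subseteq> K"
    using hexagon_cover unfolding N_def K_def by blast
  ultimately have "z \<in> interior K"
    using interiorI by blast
  with z(2) show False
    unfolding frontier_def by blast
qed

theorem theorem2p6:
  fixes ps :: "complex list" and A B :: "(face \<Rightarrow> bool) set"
  assumes "self_avoiding_polygon ps"
    and "increasing_event (dom_faces ps) A"
    and "increasing_event (dom_faces ps) B"
  shows "nu (dom_faces ps) (A \<inter> B) \<ge> nu (dom_faces ps) A * nu (dom_faces ps) B"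
proof (rule nu_fkg)
  show "finite (dom_faces ps)"
    by (rule finite_dom_faces[OF assms(1)])
  \<comment> \<open>The domain has no faces when, for instance, the polygon bounds a single hexagon;
    then exactness is trivial.\<close>
  then show "cocycles_exact (dom_faces ps)"
    using cocycles_exact_empty cocycles_exact_if_no_holes dom_faces_no_holes[OF assms(1)]
    by (cases "dom_faces ps = {}") auto
qed (rule assms)+

end
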